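(* The satisfiability problem for $\mathrm{F}_1[\mathrm{succ}]$ and for $\mathrm{F}_1[<]$ over words is undecidable when the signature additionally contains a binary relation symbol $R$ whose interpretation is arbitrary (uninterpreted).
   Context: A word is a finite structure over $\sigma_0\cup\{\mathrm{succ},<\}$, $\sigma_0$ a finite set of unary relation symbols, $<$ a strict linear order and $\mathrm{succ}$ its induced successor; $\mathrm{F}_1[\mathrm{succ}]$ (resp. $\mathrm{F}_1[<]$) means formulas may use, besides unary symbols, only the navigational symbol $\mathrm{succ}$ (resp. $<$), here together with the extra binary symbol $R$. $\mathrm{F}_1$ (one-dimensional fragment) is the smallest set of first-order formulas containing atoms and equalities, closed under $\vee,\neg$, and such that if $\varphi$ has free variables among $x_0,\dots,x_k$ then $\exists x_0\dots x_k\varphi$ and $\exists x_1\dots x_k\varphi$ are in it. *)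

theory Defs
  imports Main "HOL-Library.Nat_Bijection"
begin

section \<open>First-order formulas and the one-dimensional fragment\<close>

datatype bin_sym = SuccSym | LessSym | RSym

text \<open>
  Variables and unary relation symbols are named by natural numbers: each formula uses finitely
  many unary symbols, drawn from an unlimited supply.
\<close>

datatype fm =
    Unary nat nat
  | Binary bin_sym nat nat
  | Equal nat nat
  | Neg fm
  | Disj fm fm
  | Exi nat fm

primrec fv :: "fm \<Rightarrow> nat set" where
  "fv (Unary P x) = {x}"
| "fv (Binary b x y) = {x, y}"
| "fv (Equal x y) = {x, y}"
| "fv (Neg \<phi>) = fv \<phi>"
| "fv (Disj \<phi> \<psi>) = fv \<phi> \<union> fv \<psi>"
| "fv (Exi x \<phi>) = fv \<phi> - {x}"

primrec unary_syms :: "fm \<Rightarrow> nat set" where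
  "unary_syms (Unary P x) = {P}"
| "unary_syms (Binary b x y) = {}"
| "unary_syms (Equal x y) = {}"
| "unary_syms (Neg \<phi>) = unary_syms \<phi>"
| "unary_syms (Disj \<phi> \<psi>) = unary_syms \<phi> \<union> unary_syms \<psi>"
| "unary_syms (Exi x \<phi>) = unary_syms \<phi>"

primrec binary_syms :: "fm \<Rightarrow> bin_sym set" where
  "binary_syms (Unary P x) = {}"
| "binary_syms (Binary b x y) = {b}"
| "binary_syms (Equal x y) = {}"
| "binary_syms (Neg \<phi>) = binary_syms \<phi>"
| "binary_syms (Disj \<phi> \<psi>) = binary_syms \<phi> \<union> binary_syms \<psi>"
| "binary_syms (Exi x \<phi>) = binary_syms \<phi>"

abbreviation Exis :: "nat list \<Rightarrow> fm \<Rightarrow> fm" where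
  "Exis xs \<phi> \<equiv> foldr Exi xs \<phi>"

inductive_set F1 :: "fm set" where
  un: "Unary P x \<in> F1"
| bin: "Binary b x y \<in> F1"
| equal: "Equal x y \<in> F1"
| neg: "\<phi> \<in> F1 \<Longrightarrow> Neg \<phi> \<in> F1"
| disj: "\<phi> \<in> F1 \<Longrightarrow> \<psi> \<in> F1 \<Longrightarrow> Disj \<phi> \<psi> \<in> F1"
| exi_all: "\<phi> \<in> F1 \<Longrightarrow> distinct (x # xs) \<Longrightarrow> fv \<phi> \<subseteq> set (x # xs) \<Longrightarrow> Exis (x # xs) \<phi> \<in> F1"
| exi_but_one: "\<phi> \<in> F1 \<Longrightarrow> distinct (x # xs) \<Longrightarrow> fv \<phi> \<subseteq> set (x # xs) \<Longrightarrow> Exis xs \<phi> \<in> F1"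

text \<open>
  \<open>F1_sentences SuccSym\<close> and \<open>F1_sentences LessSym\<close> are the sentences of
  $\mathrm{F}_1[\mathrm{succ}]$ and $\mathrm{F}_1[<]$, both with the extra symbol \<open>RSym\<close>.
\<close>

definition F1_sentences :: "bin_sym \<Rightarrow> fm set" where
  "F1_sentences nav = {\<phi> \<in> F1. binary_syms \<phi> \<subseteq> {nav, RSym} \<and> fv \<phi> = {}}"


section \<open>Words\<close>

record 'a struct =
  univ :: "'a set"
  un_int :: "nat \<Rightarrow> 'a set"
  bin_int :: "bin_sym \<Rightarrow> ('a \<times> 'a) set"

definition induced_succ :: "('a \<times> 'a) set \<Rightarrow> ('a \<times> 'a) set" where
  "induced_succ r = {(a, b). (a, b) \<in> r \<and> \<not> (\<exists>c. (a, c) \<in> r \<and> (c, b) \<in> r)}"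

text \<open>
  Words over the unary signature \<open>\<sigma>\<close>, expanded by an arbitrary binary relation interpreting
  \<open>RSym\<close>. Symbols outside \<open>\<sigma>\<close> are not part of the structure; they get the dummy
  value \<open>{}\<close>.
\<close>

definition word :: "nat set \<Rightarrow> 'a struct \<Rightarrow> bool" where
  "word \<sigma> M \<longleftrightarrow>
     finite \<sigma> \<and> finite (univ M) \<and> univ M \<noteq> {} \<and>
     (\<forall>P \<in> \<sigma>. un_int M P \<subseteq> univ M) \<and> (\<forall>P. P \<notin> \<sigma> \<longrightarrow> un_int M P = {}) \<and>
     bin_int M LessSym \<subseteq> univ M \<times> univ M \<and>
     strict_linear_order_on (univ M) (bin_int M LessSym) \<and>
     bin_int M SuccSym = induced_succ (bin_int M LessSym) \<and>
     bin_int M RSym \<subseteq> univ M \<times> univ M"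

primrec sat :: "'a struct \<Rightarrow> (nat \<Rightarrow> 'a) \<Rightarrow> fm \<Rightarrow> bool" where
  "sat M v (Unary P x) \<longleftrightarrow> v x \<in> un_int M P"
| "sat M v (Binary b x y) \<longleftrightarrow> (v x, v y) \<in> bin_int M b"
| "sat M v (Equal x y) \<longleftrightarrow> v x = v y"
| "sat M v (Neg \<phi>) \<longleftrightarrow> \<not> sat M v \<phi>"
| "sat M v (Disj \<phi> \<psi>) \<longleftrightarrow> sat M v \<phi> \<or> sat M v \<psi>"
| "sat M v (Exi x \<phi>) \<longleftrightarrow> (\<exists>a \<in> univ M. sat M (v(x := a)) \<phi>)"

definition models :: "'a struct \<Rightarrow> fm \<Rightarrow> bool" where
  "models M \<phi> \<longleftrightarrow> (\<forall>v. range v \<subseteq> univ M \<longrightarrow> sat M v \<phi>)"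

text \<open>
  Words are finite, so up to isomorphism it suffices to consider universes that are sets of
  natural numbers.
\<close>

definition satisfiable_over_words :: "fm \<Rightarrow> bool" where
  "satisfiable_over_words \<phi> \<longleftrightarrow>
     (\<exists>\<sigma> (M :: nat struct). unary_syms \<phi> \<subseteq> \<sigma> \<and> word \<sigma> M \<and> models M \<phi>)"


section \<open>Decidability\<close>

text \<open>
  Partial recursive functions: \<open>rec_eval f xs y\<close> means that \<open>f\<close> is defined on the
  arguments \<open>xs\<close> with value \<open>y\<close>. Primitive recursion runs on the first argument, and
  minimization requires all earlier values to be defined and nonzero.
\<close>

datatype recf =
    ZeroF
  | SuccF
  | Proj nat
  | Comp recf "recf list"
  | PrimRec recf recf
  | Mu recf

inductive rec_eval :: "recf \<Rightarrow> nat list \<Rightarrow> nat \<Rightarrow> bool" where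
  zero: "rec_eval ZeroF xs 0"
| succ: "rec_eval SuccF [x] (Suc x)"
| proj: "i < length xs \<Longrightarrow> rec_eval (Proj i) xs (xs ! i)"
| comp: "list_all2 (\<lambda>g y. rec_eval g xs y) gs ys \<Longrightarrow> rec_eval f ys z \<Longrightarrow>
           rec_eval (Comp f gs) xs z"
| primrec_0: "rec_eval f xs y \<Longrightarrow> rec_eval (PrimRec f g) (0 # xs) y"
| primrec_Suc: "rec_eval (PrimRec f g) (n # xs) r \<Longrightarrow> rec_eval g (n # r # xs) y \<Longrightarrow>
           rec_eval (PrimRec f g) (Suc n # xs) y"
| mu: "rec_eval f (n # xs) 0 \<Longrightarrow> (\<forall>m<n. \<exists>k. rec_eval f (m # xs) (Suc k)) \<Longrightarrow>
           rec_eval (Mu f) xs n"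

text \<open>
  A decision problem has a set \<open>I\<close> of instances, numbered by \<open>code\<close>, and a question
  \<open>Q\<close> about them. A decision procedure has to halt with the right answer on every instance;
  its behaviour on numbers that do not code instances is irrelevant.
\<close>

definition decidable_problem :: "('i \<Rightarrow> nat) \<Rightarrow> 'i set \<Rightarrow> ('i \<Rightarrow> bool) \<Rightarrow> bool" where
  "decidable_problem code I Q \<longleftrightarrow>
     (\<exists>f. \<forall>i \<in> I. rec_eval f [code i] (if Q i then 1 else 0))"

primrec bin_sym_code :: "bin_sym \<Rightarrow> nat" where
  "bin_sym_code SuccSym = 0"
| "bin_sym_code LessSym = 1"
| "bin_sym_code RSym = 2"

primrec fm_code :: "fm \<Rightarrow> nat" where
  "fm_code (Unary P x) = prod_encode (0, prod_encode (P, x))"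
| "fm_code (Binary b x y) = prod_encode (1, prod_encode (bin_sym_code b, prod_encode (x, y)))"
| "fm_code (Equal x y) = prod_encode (2, prod_encode (x, y))"
| "fm_code (Neg \<phi>) = prod_encode (3, fm_code \<phi>)"
| "fm_code (Disj \<phi> \<psi>) = prod_encode (4, prod_encode (fm_code \<phi>, fm_code \<psi>))"
| "fm_code (Exi x \<phi>) = prod_encode (5, prod_encode (x, fm_code \<phi>))"

end

theory Submission
  imports Defs "HOL-Library.Countable"
begin

text \<open>
  The formulas use only \<open>R\<close>, unary predicates and equality, so a single reduction serves both
  fragments. Every partial recursive \<open>f\<close> is turned into a finite Horn program over the
  successor structure of the natural numbers. A derivation is a list of facts, and a word describes
  it as follows. The \<open>Obj\<close> elements are linearly ordered by \<open>R\<close>; the one of rank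
  \<open>m\<close> stands both for the number \<open>m\<close> and for line \<open>m\<close> of the derivation. Line
  \<open>e\<close> has \<open>j\<close>-th argument \<open>a\<close> if \<open>R e p\<close> and \<open>R p a\<close> for some
  \<open>p\<close> marked \<open>Tag j\<close>. That every line follows from earlier ones by a clause is a
  condition $\forall e\, (\ldots \rightarrow \bigvee \exists \bar{x}\, \ldots)$ with a
  quantifier-free kernel, hence one-dimensional. This gives a sentence \<open>\<psi>\<close> such that, for all
  \<open>n\<close>, \<open>\<psi> \<and> input n\<close> is satisfiable iff \<open>f n = 0\<close>, where \<open>input n\<close> says
  that the marked input has rank \<open>n\<close>.

  No universal function is needed. Given a decision procedure \<open>d\<close>, apply this to
  \<open>f n = d (code (\<phi> \<and> input n))\<close> with \<open>n\<close> the code of \<open>\<phi>\<close>, and take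
  for \<open>\<phi>\<close> the sentence \<open>\<psi>\<close> obtained for \<open>f\<close> itself.
\<close>

section \<open>Partial recursive functions as Horn programs\<close>

inductive_cases rec_eval_ZeroF [elim!]: "rec_eval ZeroF xs y"
inductive_cases rec_eval_SuccF [elim!]: "rec_eval SuccF xs y"
inductive_cases rec_eval_Proj [elim!]: "rec_eval (Proj i) xs y"
inductive_cases rec_eval_Comp [elim!]: "rec_eval (Comp f gs) xs y"
inductive_cases rec_eval_PrimRec_Nil [elim!]: "rec_eval (PrimRec f g) [] y"
inductive_cases rec_eval_PrimRec_0 [elim!]: "rec_eval (PrimRec f g) (0 # xs) y"
inductive_cases rec_eval_PrimRec_Suc [elim!]: "rec_eval (PrimRec f g) (Suc n # xs) y"
inductive_cases rec_eval_Mu [elim!]: "rec_eval (Mu f) xs y"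

lemma rec_eval_deterministic: "rec_eval f xs y \<Longrightarrow> rec_eval f xs z \<Longrightarrow> y = z"
proof (induction arbitrary: z rule: rec_eval.induct)
  case (comp xs gs ys f y)
  from comp.prems obtain zs where zs: "list_all2 (\<lambda>g y. rec_eval g xs y) gs zs" "rec_eval f zs z"
    by (rule rec_eval_Comp)
  have "ys ! i = zs ! i" if "i < length gs" for i
    using comp.IH(1) zs(1) that unfolding list_all2_conv_all_nth by simp
  then have "ys = zs"
    using comp.IH(1) zs(1) by (simp add: list_all2_conv_all_nth list_eq_iff_nth_eq)
  with zs(2) comp.IH(2) show ?case by simp
next
  case (mu f n xs)
  from mu.prems have z: "rec_eval f (z # xs) 0" "\<forall>m<z. \<exists>k. rec_eval f (m # xs) (Suc k)"
    by (elim rec_eval_Mu; simp)+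
  \<comment> \<open>At the smaller of two distinct candidates \<open>f\<close> would be both zero
    and positive.\<close>
  have "\<not> n < z" using z(2) mu.IH(1) by fastforce
  moreover have "\<not> z < n" using z(1) mu.IH(2) by fastforce
  ultimately show ?case by simp
next
  case (primrec_0 f xs y g)
  then show ?case by (elim rec_eval_PrimRec_0) simp
next
  case (primrec_Suc f g n xs r y)
  from primrec_Suc.prems obtain r' where
    "rec_eval (PrimRec f g) (n # xs) r'" "rec_eval g (n # r' # xs) z"
    by (rule rec_eval_PrimRec_Suc)
  with primrec_Suc.IH show ?case by simp
qed auto

section \<open>Computable functions of one argument, up to the pairing function\<close>

definition computable :: "(nat \<Rightarrow> nat) \<Rightarrow> bool" where
  "computable F \<longleftrightarrow> (\<exists>f. \<forall>x. rec_eval f [x] (F x))"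

lemma rec_eval_comp1: "rec_eval g xs y \<Longrightarrow> rec_eval f [y] z \<Longrightarrow> rec_eval (Comp f [g]) xs z"
  by (rule rec_eval.comp[where ys = "[y]"]) auto

lemma rec_eval_comp2:
  "rec_eval g xs y \<Longrightarrow> rec_eval h xs z \<Longrightarrow> rec_eval f [y, z] u \<Longrightarrow> rec_eval (Comp f [g, h]) xs u"
  by (rule rec_eval.comp[where ys = "[y, z]"]) auto

lemma rec_eval_proj0: "rec_eval (Proj 0) (x # xs) x"
  using rec_eval.proj[of 0 "x # xs"] by simp

lemma rec_eval_proj1: "rec_eval (Proj 1) (x # y # xs) y"
  using rec_eval.proj[of 1 "x # y # xs"] by simp

lemma rec_eval_const: "rec_eval (((\<lambda>f. Comp SuccF [f]) ^^ c) ZeroF) xs c"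
  by (induction c) (auto intro: rec_eval_comp1 rec_eval.zero rec_eval.succ)

lemma rec_eval_add: "rec_eval (PrimRec (Proj 0) (Comp SuccF [Proj 1])) [x, y] (x + y)"
proof (induction x)
  case (Suc x)
  \<comment> \<open>The step function receives the counter, the previous value and the parameters in
    this order, so \<open>Proj 1\<close> is the previous value.\<close>
  show ?case
    by (rule rec_eval.primrec_Suc[OF Suc.IH])
      (auto intro: rec_eval_comp1 rec_eval_proj1[unfolded One_nat_def] rec_eval.succ)
qed (auto intro: rec_eval.primrec_0 rec_eval_proj0)

text \<open>Preparation for pairing: \<open>prod_encode (m, n)\<close> is
  \<open>triangle (m + n) + m\<close>, and \<open>triangle (Suc n)\<close> is
  \<open>triangle n + Suc n\<close>.\<close>

lemma computable_triangle: "computable triangle"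
proof -
  let ?add = "PrimRec (Proj 0) (Comp SuccF [Proj 1])"
  have "rec_eval (PrimRec ZeroF (Comp SuccF [Comp ?add [Proj 0, Proj 1]])) [x] (triangle x)" for x
  proof (induction x)
    case (Suc x)
    have "rec_eval (Comp SuccF [Comp ?add [Proj 0, Proj 1]]) [x, triangle x] (Suc (x + triangle x))"
      by (rule rec_eval_comp1[OF rec_eval_comp2[OF rec_eval_proj0 rec_eval_proj1 rec_eval_add] rec_eval.succ])
    then show ?case using rec_eval.primrec_Suc[OF Suc.IH] by (simp add: add.commute)
  qed (auto intro: rec_eval.intros)
  then show ?thesis unfolding computable_def by blast
qed

lemma computable_const: "computable (\<lambda>_. c)"
  unfolding computable_def using rec_eval_const by blast

lemma computable_id: "computable (\<lambda>x. x)"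
  unfolding computable_def using rec_eval_proj0 by blast

lemma computable_prod_encode:
  assumes "computable F" "computable G"
  shows "computable (\<lambda>x. prod_encode (F x, G x))"
proof -
  let ?add = "PrimRec (Proj 0) (Comp SuccF [Proj 1])"
  obtain f g t where "\<And>x. rec_eval f [x] (F x)" "\<And>x. rec_eval g [x] (G x)"
    "\<And>x. rec_eval t [x] (triangle x)"
    using assms computable_triangle unfolding computable_def by blast
  then have "rec_eval (Comp ?add [Comp t [Comp ?add [f, g]], f]) [x] (prod_encode (F x, G x))" for x
    unfolding prod_encode_def prod.case
    by (intro rec_eval_comp2[OF rec_eval_comp1[OF rec_eval_comp2[OF _ _ rec_eval_add]] _ rec_eval_add])
  then show ?thesis unfolding computable_def by blast
qed

text \<open>The codes of the rank formulas arise by iterating one operation on codes; this lemma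
  makes them computable in the number of iterations.\<close>

lemma computable_funpow:
  assumes "computable H"
  shows "computable (\<lambda>n. (H ^^ n) c)"
proof -
  obtain h where h: "\<And>x. rec_eval h [x] (H x)" using assms unfolding computable_def by blast
  have "rec_eval (PrimRec (((\<lambda>f. Comp SuccF [f]) ^^ c) ZeroF) (Comp h [Proj 1])) [n] ((H ^^ n) c)" for n
  proof (induction n)
    case 0
    then show ?case by (auto intro: rec_eval.primrec_0 rec_eval_const)
  next
    case (Suc n)
    show ?case by (rule rec_eval.primrec_Suc[OF Suc.IH])
      (auto intro: rec_eval_comp1 rec_eval_proj1[unfolded One_nat_def] h)
  qed
  then show ?thesis unfolding computable_def by blast
qed

section \<open>Horn clauses for recursive functions and their soundness\<close>

instance recf :: countable
  by countable_datatype

text \<open>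
  \<open>EvP f k\<close> relates a value and \<open>k\<close> arguments of \<open>f\<close>. \<open>MuP f k\<close> holds for
  \<open>n # xs\<close> of length \<open>Suc k\<close> if \<open>f\<close> is defined and positive on \<open>m # xs\<close> for all
  \<open>m < n\<close>; it unfolds the bounded quantifier of minimization recursively.
\<close>

datatype pred = ZeroP | SuccP | EvP recf nat | MuP recf nat

text \<open>Unary symbols are natural numbers, so predicates enter formulas through
  \<open>to_nat\<close>.\<close>

instance pred :: countable
  by countable_datatype

text \<open>The list of an atom contains clause variables, not values.\<close>

type_synonym atom = "pred \<times> nat list"
type_synonym clause = "atom \<times> atom list"

text \<open>Least model semantics over the successor structure. Each use of a clause picks its own
  \<open>\<nu>\<close>, so variables that occur only in a body are existential.\<close>

inductive derivable :: "clause set \<Rightarrow> pred \<Rightarrow> nat list \<Rightarrow> bool" for Q where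
  zero: "derivable Q ZeroP [0]"
| succ: "derivable Q SuccP [m, Suc m]"
| clause: "((p, xs), b) \<in> Q \<Longrightarrow> \<forall>a \<in> set b. derivable Q (fst a) (map \<nu> (snd a)) \<Longrightarrow>
             derivable Q p (map \<nu> xs)"

lemma derivable_mono: "derivable Q p xs \<Longrightarrow> Q \<subseteq> Q' \<Longrightarrow> derivable Q' p xs"
proof (induction rule: derivable.induct)
  case (clause p xs b \<nu>)
  then show ?case by (intro derivable.clause[of p xs b]) auto
qed (auto intro: derivable.zero derivable.succ)

text \<open>Layout of the clause variables: 0 is the value (for \<open>MuP\<close> the bound), 1 to
  \<open>k\<close> are the arguments of a \<open>k\<close>-ary head, larger ones hold intermediate
  results. In \<open>comp\<close>, variable \<open>Suc k + i\<close> is the value of the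
  \<open>i\<close>-th inner function; in \<open>primrec_Suc\<close>, \<open>k + 2\<close> is the
  predecessor and \<open>k + 3\<close> the previous value; in \<open>mu_Suc\<close>, the predecessor
  \<open>k + 3\<close> certifies that the value \<open>k + 2\<close> is positive. In
  \<open>proj\<close> the head repeats a variable to express an equality.\<close>

inductive_set rec_clauses :: "clause set" where
  zero: "((EvP ZeroF k, [0..<Suc k]), [(ZeroP, [0])]) \<in> rec_clauses"
| succ: "((EvP SuccF (Suc 0), [0, 1]), [(SuccP, [1, 0])]) \<in> rec_clauses"
| proj: "i < k \<Longrightarrow> ((EvP (Proj i) k, Suc i # [1..<Suc k]), []) \<in> rec_clauses"
| comp: "((EvP (Comp f gs) k, [0..<Suc k]),
    (EvP f (length gs), 0 # [Suc k..<Suc k + length gs]) #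
    map (\<lambda>i. (EvP (gs ! i) k, (Suc k + i) # [1..<Suc k])) [0..<length gs]) \<in> rec_clauses"
| primrec_0: "((EvP (PrimRec f g) (Suc k), [0..<k + 2]),
    [(ZeroP, [1]), (EvP f k, 0 # [2..<k + 2])]) \<in> rec_clauses"
| primrec_Suc: "((EvP (PrimRec f g) (Suc k), [0..<k + 2]),
    [(SuccP, [k + 2, 1]), (EvP (PrimRec f g) (Suc k), (k + 3) # (k + 2) # [2..<k + 2]),
     (EvP g (k + 2), 0 # (k + 2) # (k + 3) # [2..<k + 2])]) \<in> rec_clauses"
| mu: "((EvP (Mu f) k, [0..<Suc k]),
    [(MuP f k, [0..<Suc k]), (EvP f (Suc k), Suc k # [0..<Suc k]), (ZeroP, [Suc k])]) \<in> rec_clauses"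
| mu_0: "((MuP f k, [0..<Suc k]), [(ZeroP, [0])]) \<in> rec_clauses"
| mu_Suc: "((MuP f k, [0..<Suc k]),
    [(SuccP, [k + 1, 0]), (MuP f k, (k + 1) # [1..<Suc k]),
     (EvP f (Suc k), (k + 2) # (k + 1) # [1..<Suc k]), (SuccP, [k + 3, k + 2])]) \<in> rec_clauses"

primrec arity :: "pred \<Rightarrow> nat" where
  "arity ZeroP = 1"
| "arity SuccP = 2"
| "arity (EvP f k) = Suc k"
| "arity (MuP f k) = Suc k"

lemma length_rec_clauses:
  assumes "((p, xs), b) \<in> rec_clauses" "a \<in> set ((p, xs) # b)"
  shows "length (snd a) = arity (fst a)"
  using assms by (cases rule: rec_clauses.cases) (auto simp del: upt_Suc)

lemma rec_clauses_head:
  "((p, xs), b) \<in> rec_clauses \<Longrightarrow> p \<noteq> ZeroP \<and> p \<noteq> SuccP"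
  by (erule rec_clauses.cases) auto

primrec meaning :: "pred \<Rightarrow> nat list \<Rightarrow> bool" where
  "meaning ZeroP xs \<longleftrightarrow> xs = [0]"
| "meaning SuccP xs \<longleftrightarrow> (\<exists>m. xs = [m, Suc m])"
| "meaning (EvP f k) xs \<longleftrightarrow> rec_eval f (tl xs) (hd xs)"
| "meaning (MuP f k) xs \<longleftrightarrow> (\<forall>m<hd xs. \<exists>r. rec_eval f (m # tl xs) (Suc r))"

text \<open>Soundness: each clause is true under the intended meaning, whichever subset of the
  clauses is chosen as the program.\<close>

lemma derivable_meaning: "derivable Q p xs \<Longrightarrow> Q \<subseteq> rec_clauses \<Longrightarrow> meaning p xs"
proof (induction rule: derivable.induct)
  case (clause p xs b \<nu>)
  then have "((p, xs), b) \<in> rec_clauses"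
    and b: "\<forall>a\<in>set b. meaning (fst a) (map \<nu> (snd a))" by auto
  \<comment> \<open>Splits off variable 0, and for primitive recursion also variable 1, so that
    \<open>hd\<close> and \<open>tl\<close> in \<open>meaning\<close> can be evaluated.\<close>
  moreover have upt0: "[0..<Suc k] = 0 # [1..<Suc k]" "[0..<k + 2] = 0 # 1 # [2..<k + 2]" for k
    by (simp_all add: upt_rec numeral_2_eq_2 del: upt_Suc)
  ultimately show ?case
  proof (cases rule: rec_clauses.cases)
    case (comp f gs k)
    have "list_all2 (\<lambda>g y. rec_eval g (map \<nu> [1..<Suc k]) y) gs (map \<nu> [Suc k..<Suc k + length gs])"
      using b comp by (simp add: list_all2_conv_all_nth del: upt_Suc)
    with b comp show ?thesis
      by (auto simp: upt0 simp del: upt_Suc intro: rec_eval.comp)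
  next
    case (proj i k)
    then show ?thesis using rec_eval.proj[of i "map \<nu> [1..<Suc k]"] by (simp del: upt_Suc)
  next
    case (mu_Suc f k)
    with b show ?thesis by (auto simp: upt0 less_Suc_eq simp del: upt_Suc)
  qed (use b in \<open>auto simp: upt0 simp del: upt_Suc intro: rec_eval.intros\<close>)
qed auto

section \<open>Completeness: finite programs for all recursive functions\<close>

lemma map_nth_upt: "b \<le> length zs \<Longrightarrow> map ((!) zs) [a..<b] = take (b - a) (drop a zs)"
  by (rule nth_equalityI) auto

text \<open>A clause is instantiated by a list: variable \<open>i\<close> receives
  \<open>zs ! i\<close>. With the variable layout of \<open>rec_clauses\<close>, such a list is the
  head's value or bound, then the arguments, then the intermediate results.\<close>

lemma derivable_clause_nth:
  assumes "c \<in> Q" "fst c = (p, is)" "\<forall>a \<in> set (snd c). derivable Q (fst a) (map ((!) zs) (snd a))"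
    "map ((!) zs) is = xs"
  shows "derivable Q p xs"
  using derivable.clause[of p "is" "snd c" Q] assms by (metis prod.collapse)

text \<open>Only completeness is demanded, since soundness follows from
  \<open>Q \<subseteq> rec_clauses\<close>. Finiteness is what allows the program to be written into
  a single sentence.\<close>

definition has_program :: "recf \<Rightarrow> nat \<Rightarrow> bool" where
  "has_program f k \<longleftrightarrow> (\<exists>Q. finite Q \<and> Q \<subseteq> rec_clauses \<and>
     (\<forall>xs y. length xs = k \<longrightarrow> rec_eval f xs y \<longrightarrow> derivable Q (EvP f k) (y # xs)))"

lemma has_programI:
  assumes "finite Q" "Q \<subseteq> rec_clauses"
    "\<And>xs y. length xs = k \<Longrightarrow> rec_eval f xs y \<Longrightarrow> derivable Q (EvP f k) (y # xs)"
  shows "has_program f k"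
  using assms unfolding has_program_def by blast

text \<open>Monotonicity is built in, so that the programs of subfunctions can be used inside a
  larger program.\<close>

lemma has_programE:
  assumes "has_program f k"
  obtains Q where "finite Q" "Q \<subseteq> rec_clauses"
    "\<And>Q' xs y. length xs = k \<Longrightarrow> rec_eval f xs y \<Longrightarrow> Q \<subseteq> Q' \<Longrightarrow> derivable Q' (EvP f k) (y # xs)"
  using assms unfolding has_program_def by (metis derivable_mono)

lemma has_program_ZeroF: "has_program ZeroF k"
proof -
  define c where "c = ((EvP ZeroF k, [0..<Suc k]), [(ZeroP, [0::nat])])"
  have "derivable {c} (EvP ZeroF k) (y # xs)" if "length xs = k" "rec_eval ZeroF xs y" for xs y
    using that by (intro derivable_clause_nth[where zs = "y # xs" and c = c])
     (auto simp: map_nth_upt c_def simp del: upt_Suc intro: derivable.zero)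
  moreover have "c \<in> rec_clauses" unfolding c_def by (rule rec_clauses.zero)
  ultimately show ?thesis by (intro has_programI[of "{c}"]) auto
qed

lemma has_program_SuccF: "has_program SuccF k"
proof -
  define c where "c = ((EvP SuccF (Suc 0), [0, 1::nat]), [(SuccP, [1, 0::nat])])"
  have "derivable {c} (EvP SuccF k) (y # xs)" if "length xs = k" "rec_eval SuccF xs y" for xs y
    using that by (intro derivable_clause_nth[where zs = "y # xs" and c = c])
     (auto simp: c_def intro: derivable.succ)
  moreover have "c \<in> rec_clauses" unfolding c_def by (rule rec_clauses.succ)
  ultimately show ?thesis by (intro has_programI[of "{c}"]) auto
qed

lemma has_program_Proj: "has_program (Proj i) k"
proof (cases "i < k")
  case True
  define c where "c = ((EvP (Proj i) k, Suc i # [1..<Suc k]), [] :: atom list)"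
  have "derivable {c} (EvP (Proj i) k) (y # xs)" if "length xs = k" "rec_eval (Proj i) xs y" for xs y
    using that by (intro derivable_clause_nth[where zs = "y # xs" and c = c])
     (auto simp: map_nth_upt c_def simp del: upt_Suc)
  moreover have "c \<in> rec_clauses" unfolding c_def by (rule rec_clauses.proj[OF True])
  ultimately show ?thesis by (intro has_programI[of "{c}"]) auto
next
  case False
  \<comment> \<open>An index out of range makes the projection undefined, so there is nothing to
    derive.\<close>
  then show ?thesis by (intro has_programI[of "{}"]) auto
qed

lemma has_program_Comp:
  assumes "has_program f (length gs)" "\<And>g. g \<in> set gs \<Longrightarrow> has_program g k"
  shows "has_program (Comp f gs) k"
proof -
  define c where "c = ((EvP (Comp f gs) k, [0..<Suc k]),
    (EvP f (length gs), 0 # [Suc k..<Suc k + length gs]) #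
    map (\<lambda>i. (EvP (gs ! i) k, (Suc k + i) # [1..<Suc k])) [0..<length gs])"
  obtain Q where Q: "finite Q" "Q \<subseteq> rec_clauses"
    "\<And>Q' xs y. length xs = length gs \<Longrightarrow> rec_eval f xs y \<Longrightarrow> Q \<subseteq> Q' \<Longrightarrow>
       derivable Q' (EvP f (length gs)) (y # xs)"
    using has_programE[OF assms(1)] by metis
  have "\<forall>g\<in>set gs. \<exists>Q. finite Q \<and> Q \<subseteq> rec_clauses \<and> (\<forall>xs y Q'. length xs = k \<longrightarrow>
      rec_eval g xs y \<longrightarrow> Q \<subseteq> Q' \<longrightarrow> derivable Q' (EvP g k) (y # xs))"
    using has_programE[OF assms(2)] by metis
  then obtain P where P: "\<And>g. g \<in> set gs \<Longrightarrow> finite (P g) \<and> P g \<subseteq> rec_clauses"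
    "\<And>g xs y Q'. g \<in> set gs \<Longrightarrow> length xs = k \<Longrightarrow> rec_eval g xs y \<Longrightarrow> P g \<subseteq> Q' \<Longrightarrow>
       derivable Q' (EvP g k) (y # xs)"
    by metis
  define C where "C = insert c (Q \<union> (\<Union>g\<in>set gs. P g))"
  then have C: "c \<in> C" "Q \<subseteq> C" "\<And>g. g \<in> set gs \<Longrightarrow> P g \<subseteq> C" by auto
  have "derivable C (EvP (Comp f gs) k) (y # xs)"
    if xs: "length xs = k" and ev: "rec_eval (Comp f gs) xs y" for xs y
  proof -
    from ev obtain ys where ys: "list_all2 (\<lambda>g y. rec_eval g xs y) gs ys" "rec_eval f ys y"
      by auto
    then have l: "length ys = length gs" by (simp add: list_all2_lengthD)
    have "derivable C (EvP f (length gs)) (y # ys)"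
      by (rule Q(3)[OF l ys(2) C(2)])
    moreover have "derivable C (EvP (gs ! i) k) (ys ! i # xs)" if "i < length gs" for i
      using P(2)[of "gs ! i", OF _ xs] ys(1) C(3) that by (simp add: list_all2_conv_all_nth)
    ultimately show ?thesis using C(1)
      \<comment> \<open>The inner values \<open>ys\<close> come after the \<open>Suc k\<close>
        entries of \<open>y # xs\<close>, hence at the variables from \<open>Suc k\<close>
        on.\<close>
      by (intro derivable_clause_nth[where zs = "y # xs @ ys" and c = c])
       (auto simp: map_nth_upt nth_append c_def l xs simp del: upt_Suc)
  qed
  moreover have "c \<in> rec_clauses" unfolding c_def by (rule rec_clauses.comp)
  ultimately show ?thesis using Q(1,2) P(1) by (intro has_programI[of C]) (auto simp: C_def subset_iff)
qed

lemma has_program_PrimRec: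
  assumes "\<And>k. has_program f k" "\<And>k. has_program g k"
  shows "has_program (PrimRec f g) k"
proof (cases k)
  case 0
  \<comment> \<open>Primitive recursion is undefined on the empty argument list.\<close>
  then show ?thesis by (intro has_programI[of "{}"]) auto
next
  case (Suc k')
  define c where "c = ((EvP (PrimRec f g) (Suc k'), [0..<k' + 2]),
    [(ZeroP, [1]), (EvP f k', 0 # [2..<k' + 2])])"
  define d where "d = ((EvP (PrimRec f g) (Suc k'), [0..<k' + 2]),
    [(SuccP, [k' + 2, 1]), (EvP (PrimRec f g) (Suc k'), (k' + 3) # (k' + 2) # [2..<k' + 2]),
    (EvP g (k' + 2), 0 # (k' + 2) # (k' + 3) # [2..<k' + 2])])"
  obtain Q where Q: "finite Q" "Q \<subseteq> rec_clauses"
    "\<And>Q' xs y. length xs = k' \<Longrightarrow> rec_eval f xs y \<Longrightarrow> Q \<subseteq> Q' \<Longrightarrow> derivable Q' (EvP f k') (y # xs)"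
    using has_programE[OF assms(1)] by metis
  obtain P where P: "finite P" "P \<subseteq> rec_clauses"
    "\<And>Q' xs y. length xs = k' + 2 \<Longrightarrow> rec_eval g xs y \<Longrightarrow> P \<subseteq> Q' \<Longrightarrow>
       derivable Q' (EvP g (k' + 2)) (y # xs)"
    using has_programE[OF assms(2)] by metis
  define C where "C = insert c (insert d (Q \<union> P))"
  then have C: "c \<in> C" "d \<in> C" "Q \<subseteq> C" "P \<subseteq> C" by auto
  have "derivable C (EvP (PrimRec f g) (Suc k')) (y # n # xs)"
    if xs: "length xs = k'" and ev: "rec_eval (PrimRec f g) (n # xs) y" for n xs y
    using ev
  proof (induction n arbitrary: y)
    case 0
    then have "rec_eval f xs y" by auto
    then have "derivable C (EvP f k') (y # xs)" by (rule Q(3)[OF xs _ C(3)])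
    then show ?case using C(1)
      by (intro derivable_clause_nth[where zs = "y # 0 # xs" and c = c])
       (auto simp: map_nth_upt c_def xs intro: derivable.zero simp del: upt_Suc)
  next
    case (Suc n)
    then obtain r where r: "rec_eval (PrimRec f g) (n # xs) r" "rec_eval g (n # r # xs) y"
      by auto
    have "derivable C (EvP g (k' + 2)) (y # n # r # xs)"
      by (rule P(3)[OF _ r(2) C(4)]) (simp add: xs)
    then show ?case using C(2) Suc.IH[OF r(1)]
      by (intro derivable_clause_nth[where zs = "y # Suc n # xs @ [n, r]" and c = d])
       (auto simp: map_nth_upt d_def xs nth_append numeral_3_eq_3 intro: derivable.succ simp del: upt_Suc)
  qed
  then have "derivable C (EvP (PrimRec f g) k) (y # xs)"
    if "length xs = k" "rec_eval (PrimRec f g) xs y" for xs y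
    using that Suc by (cases xs) auto
  moreover have "c \<in> rec_clauses" "d \<in> rec_clauses"
    unfolding c_def d_def by (rule rec_clauses.intros)+
  ultimately show ?thesis using Q P by (intro has_programI[of C]) (auto simp: C_def)
qed

lemma has_program_Mu:
  assumes "has_program f (Suc k)"
  shows "has_program (Mu f) k"
proof -
  define a where "a = ((EvP (Mu f) k, [0..<Suc k]),
    [(MuP f k, [0..<Suc k]), (EvP f (Suc k), Suc k # [0..<Suc k]), (ZeroP, [Suc k])])"
  define c where "c = ((MuP f k, [0..<Suc k]), [(ZeroP, [0::nat])])"
  define d where "d = ((MuP f k, [0..<Suc k]),
    [(SuccP, [k + 1, 0]), (MuP f k, (k + 1) # [1..<Suc k]),
     (EvP f (Suc k), (k + 2) # (k + 1) # [1..<Suc k]), (SuccP, [k + 3, k + 2])])"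
  obtain Q where Q: "finite Q" "Q \<subseteq> rec_clauses"
    "\<And>Q' xs y. length xs = Suc k \<Longrightarrow> rec_eval f xs y \<Longrightarrow> Q \<subseteq> Q' \<Longrightarrow>
       derivable Q' (EvP f (Suc k)) (y # xs)"
    using has_programE[OF assms] by metis
  define C where "C = insert a (insert c (insert d Q))"
  then have C: "a \<in> C" "c \<in> C" "d \<in> C" "Q \<subseteq> C" by auto
  \<comment> \<open>The bounded quantifier is climbed one value at a time, by induction on its
    bound.\<close>
  have mu: "derivable C (MuP f k) (n # xs)"
    if "length xs = k" "\<forall>m<n. \<exists>r. rec_eval f (m # xs) (Suc r)" for n xs
    using that
  proof (induction n)
    case 0
    then show ?case using C(2)
      by (intro derivable_clause_nth[where zs = "0 # xs" and c = c])
       (auto simp: map_nth_upt c_def intro: derivable.zero simp del: upt_Suc)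
  next
    case (Suc n)
    then obtain r where "rec_eval f (n # xs) (Suc r)" by blast
    then have "derivable C (EvP f (Suc k)) (Suc r # n # xs)"
      using Q(3)[OF _ _ C(4)] Suc.prems by simp
    moreover have "derivable C (MuP f k) (n # xs)" using Suc by simp
    ultimately show ?case using C(3) Suc.prems(1)
      \<comment> \<open>The last three entries are the previous bound, the value of \<open>f\<close>
        there and the predecessor that shows this value to be positive.\<close>
      by (intro derivable_clause_nth[where zs = "Suc n # xs @ [n, Suc r, r]" and c = d])
       (auto simp: map_nth_upt d_def nth_append numeral_3_eq_3 intro: derivable.succ simp del: upt_Suc)
  qed
  have "derivable C (EvP (Mu f) k) (y # xs)"
    if xs: "length xs = k" and ev: "rec_eval (Mu f) xs y" for xs y
  proof -
    from ev have e: "rec_eval f (y # xs) 0" "\<forall>m<y. \<exists>r. rec_eval f (m # xs) (Suc r)" by auto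
    have "derivable C (EvP f (Suc k)) (0 # y # xs)" by (rule Q(3)[OF _ e(1) C(4)]) (simp add: xs)
    then show ?thesis using mu[OF xs e(2)] C(1) xs
      by (intro derivable_clause_nth[where zs = "y # xs @ [0]" and c = a])
       (auto simp: map_nth_upt a_def nth_append intro: derivable.zero simp del: upt_Suc)
  qed
  moreover have "a \<in> rec_clauses" "c \<in> rec_clauses" "d \<in> rec_clauses"
    unfolding a_def c_def d_def by (rule rec_clauses.intros)+
  ultimately show ?thesis using Q by (intro has_programI[of C]) (auto simp: C_def)
qed

lemma has_program: "has_program f k"
  by (induction f arbitrary: k)
    (auto intro: has_program_ZeroF has_program_SuccF has_program_Proj has_program_Comp
      has_program_PrimRec has_program_Mu)

section \<open>One-dimensional axioms for derivations\<close>

definition Conj :: "fm \<Rightarrow> fm \<Rightarrow> fm" where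
  "Conj \<phi> \<psi> = Neg (Disj (Neg \<phi>) (Neg \<psi>))"

definition Imp :: "fm \<Rightarrow> fm \<Rightarrow> fm" where
  "Imp \<phi> \<psi> = Disj (Neg \<phi>) \<psi>"

text \<open>The syntax has no truth constants, so \<open>Equal 0 0\<close> stands in for truth. It
  makes variable 0 free, which the closing quantifiers absorb.\<close>

definition ConjL :: "fm list \<Rightarrow> fm" where
  "ConjL \<phi>s = foldr Conj \<phi>s (Equal 0 0)"

definition DisjL :: "fm list \<Rightarrow> fm" where
  "DisjL \<phi>s = foldr Disj \<phi>s (Neg (Equal 0 0))"

lemma sat_Conj [simp]: "sat M v (Conj \<phi> \<psi>) \<longleftrightarrow> sat M v \<phi> \<and> sat M v \<psi>"
  by (simp add: Conj_def)

lemma sat_Imp [simp]: "sat M v (Imp \<phi> \<psi>) \<longleftrightarrow> (sat M v \<phi> \<longrightarrow> sat M v \<psi>)"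
  by (simp add: Imp_def)

lemma sat_ConjL [simp]: "sat M v (ConjL \<phi>s) \<longleftrightarrow> (\<forall>\<phi> \<in> set \<phi>s. sat M v \<phi>)"
  unfolding ConjL_def by (induction \<phi>s) auto

lemma sat_DisjL [simp]: "sat M v (DisjL \<phi>s) \<longleftrightarrow> (\<exists>\<phi> \<in> set \<phi>s. sat M v \<phi>)"
  unfolding DisjL_def by (induction \<phi>s) auto

lemma models_Conj [simp]: "models M (Conj \<phi> \<psi>) \<longleftrightarrow> models M \<phi> \<and> models M \<psi>"
  unfolding models_def by auto

lemma models_ConjL [simp]: "models M (ConjL \<phi>s) \<longleftrightarrow> (\<forall>\<phi> \<in> set \<phi>s. models M \<phi>)"
  unfolding models_def by auto

lemma finite_fv: "finite (fv \<phi>)"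
  by (induction \<phi>) auto

lemma finite_unary_syms: "finite (unary_syms \<phi>)"
  by (induction \<phi>) auto

lemma fv_Exis [simp]: "fv (Exis xs \<phi>) = fv \<phi> - set xs"
  by (induction xs) auto

lemma binary_syms_Exis [simp]: "binary_syms (Exis xs \<phi>) = binary_syms \<phi>"
  by (induction xs) auto

lemma sat_fv_cong: "(\<And>x. x \<in> fv \<phi> \<Longrightarrow> v x = w x) \<Longrightarrow> sat M v \<phi> \<longleftrightarrow> sat M w \<phi>"
proof (induction \<phi> arbitrary: v w)
  case (Neg \<phi>)
  have "sat M v \<phi> \<longleftrightarrow> sat M w \<phi>" by (rule Neg.IH) (simp add: Neg.prems)
  then show ?case by simp
next
  case (Disj \<phi> \<psi>)
  have "sat M v \<phi> \<longleftrightarrow> sat M w \<phi>" "sat M v \<psi> \<longleftrightarrow> sat M w \<psi>"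
    by (rule Disj.IH; simp add: Disj.prems)+
  then show ?case by simp
next
  case (Exi x \<phi>)
  have "sat M (v(x := a)) \<phi> \<longleftrightarrow> sat M (w(x := a)) \<phi>" for a
    by (rule Exi.IH) (simp add: Exi.prems)
  then show ?case by simp
qed simp_all

text \<open>Allows symbols that do not occur in a formula to be emptied, as \<open>word\<close>
  requires outside the signature.\<close>

lemma sat_struct_cong:
  assumes "univ M = univ N" "bin_int M = bin_int N"
  shows "(\<And>P. P \<in> unary_syms \<phi> \<Longrightarrow> un_int M P = un_int N P) \<Longrightarrow> sat M v \<phi> \<longleftrightarrow> sat N v \<phi>"
  by (induction \<phi> arbitrary: v) (simp_all add: assms)

lemma sat_Exis:
  "sat M v (Exis xs \<phi>) \<longleftrightarrow>
     (\<exists>w. (\<forall>x \<in> set xs. w x \<in> univ M) \<and> (\<forall>x. x \<notin> set xs \<longrightarrow> w x = v x) \<and> sat M w \<phi>)"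
proof (induction xs arbitrary: v)
  case Nil
  have "(\<forall>x. w x = v x) \<longleftrightarrow> w = v" for w by auto
  then show ?case by simp
next
  case (Cons y xs)
  show ?case
  proof
    assume "sat M v (Exis (y # xs) \<phi>)"
    then obtain a w where a: "a \<in> univ M" and w: "\<forall>x \<in> set xs. w x \<in> univ M"
      "\<forall>x. x \<notin> set xs \<longrightarrow> w x = (v(y := a)) x" "sat M w \<phi>"
      using Cons by auto
    \<comment> \<open>If \<open>y\<close> recurs in \<open>xs\<close>, the inner quantifier
      overrides the value \<open>a\<close>.\<close>
    then have "w y \<in> univ M" by (cases "y \<in> set xs") auto
    with w show "\<exists>w. (\<forall>x \<in> set (y # xs). w x \<in> univ M) \<and>
        (\<forall>x. x \<notin> set (y # xs) \<longrightarrow> w x = v x) \<and> sat M w \<phi>"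
      by (intro exI[of _ w]) auto
  next
    assume "\<exists>w. (\<forall>x \<in> set (y # xs). w x \<in> univ M) \<and>
        (\<forall>x. x \<notin> set (y # xs) \<longrightarrow> w x = v x) \<and> sat M w \<phi>"
    then obtain w where "\<forall>x \<in> set (y # xs). w x \<in> univ M"
      "\<forall>x. x \<notin> set (y # xs) \<longrightarrow> w x = v x" "sat M w \<phi>" by blast
    then show "sat M v (Exis (y # xs) \<phi>)"
      unfolding foldr.simps o_apply sat.simps Cons.IH
      by (intro bexI[of _ "w y"] exI[of _ w]) auto
  qed
qed

section \<open>One-dimensional quantifier blocks\<close>

definition ExOver :: "nat \<Rightarrow> fm \<Rightarrow> fm" where
  "ExOver x \<phi> = Exis (sorted_list_of_set (fv \<phi> - {x})) \<phi>"

definition ExAll :: "fm \<Rightarrow> fm" where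
  "ExAll \<phi> = Exis (sorted_list_of_set (fv \<phi>)) \<phi>"

definition AllC :: "fm \<Rightarrow> fm" where
  "AllC \<phi> = Neg (ExAll (Neg \<phi>))"

lemma sat_ExOver:
  assumes "range v \<subseteq> univ M"
  shows "sat M v (ExOver x \<phi>) \<longleftrightarrow> (\<exists>w. range w \<subseteq> univ M \<and> w x = v x \<and> sat M w \<phi>)"
proof
  assume "sat M v (ExOver x \<phi>)"
  then obtain w where w: "\<forall>z \<in> fv \<phi> - {x}. w z \<in> univ M" "\<forall>z. z \<notin> fv \<phi> - {x} \<longrightarrow> w z = v z" "sat M w \<phi>"
    unfolding ExOver_def sat_Exis by (auto simp: finite_fv)
  moreover have "w z \<in> univ M" for z
    using w assms by (cases "z \<in> fv \<phi> - {x}") auto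
  ultimately show "\<exists>w. range w \<subseteq> univ M \<and> w x = v x \<and> sat M w \<phi>" by auto
next
  assume "\<exists>w. range w \<subseteq> univ M \<and> w x = v x \<and> sat M w \<phi>"
  then obtain w where w: "range w \<subseteq> univ M" "w x = v x" "sat M w \<phi>" by blast
  \<comment> \<open>The valuation \<open>w\<close> may differ from \<open>v\<close> anywhere except
    at \<open>x\<close>. Resetting it to \<open>v\<close> at all variables that are not quantified
    does not affect \<open>\<phi>\<close>.\<close>
  let ?w = "\<lambda>z. if z \<in> fv \<phi> - {x} then w z else v z"
  have "sat M ?w \<phi>" using w by (subst sat_fv_cong[where w = w]) auto
  then show "sat M v (ExOver x \<phi>)"
    unfolding ExOver_def sat_Exis using w(1) by (intro exI[of _ ?w]) (auto simp: finite_fv)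
qed

text \<open>With a fresh variable as the exempt one, full existential closure inherits its
  properties from \<open>ExOver\<close>.\<close>

lemma ExAll_eq_ExOver: "x \<notin> fv \<phi> \<Longrightarrow> ExAll \<phi> = ExOver x \<phi>"
  by (simp add: ExAll_def ExOver_def)

lemma obtain_not_fv:
  obtains x where "x \<notin> fv \<phi>"
  using finite_fv ex_new_if_finite infinite_UNIV_nat by blast

lemma sat_ExAll:
  assumes v: "range v \<subseteq> univ M"
  shows "sat M v (ExAll \<phi>) \<longleftrightarrow> (\<exists>w. range w \<subseteq> univ M \<and> sat M w \<phi>)"
proof -
  obtain x where x: "x \<notin> fv \<phi>" by (rule obtain_not_fv)
  have "\<exists>w. range w \<subseteq> univ M \<and> w x = v x \<and> sat M w \<phi>"
    if "range w \<subseteq> univ M" "sat M w \<phi>" for w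
  proof (intro exI conjI)
    show "range (w(x := v x)) \<subseteq> univ M" using that(1) v by auto
    show "sat M (w(x := v x)) \<phi>"
      using that(2) x by (subst sat_fv_cong[where w = w]) auto
  qed simp
  then show ?thesis unfolding ExAll_eq_ExOver[OF x] sat_ExOver[OF v] by blast
qed

text \<open>Over an empty universe there are no valuations and \<open>models\<close> would hold
  vacuously.\<close>

lemma models_ExAll:
  assumes "univ M \<noteq> {}"
  shows "models M (ExAll \<phi>) \<longleftrightarrow> (\<exists>w. range w \<subseteq> univ M \<and> sat M w \<phi>)"
proof -
  from assms obtain a where "a \<in> univ M" by blast
  then have "range (\<lambda>_::nat. a) \<subseteq> univ M" by auto
  then show ?thesis unfolding models_def using sat_ExAll[of _ M \<phi>] by blast
qed

text \<open>Since \<open>models\<close> quantifies over all valuations, open axioms need no separate closure.\<close>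

lemma models_AllC:
  assumes "univ M \<noteq> {}"
  shows "models M (AllC \<phi>) \<longleftrightarrow> models M \<phi>"
proof -
  from assms obtain a where "a \<in> univ M" by blast
  then have "range (\<lambda>_::nat. a) \<subseteq> univ M" by auto
  moreover have "sat M v (AllC \<phi>) \<longleftrightarrow> (\<forall>w. range w \<subseteq> univ M \<longrightarrow> sat M w \<phi>)"
    if "range v \<subseteq> univ M" for v
    by (simp add: AllC_def sat_ExAll[OF that])
  ultimately show ?thesis unfolding models_def by blast
qed

section \<open>Formulas of the fragment whose only binary symbol is \<open>RSym\<close>\<close>

definition F1_R :: "fm set" where
  "F1_R = {\<phi> \<in> F1. binary_syms \<phi> \<subseteq> {RSym}}"

lemma F1_R_basic [intro]:
  "Unary P x \<in> F1_R" "Binary RSym x y \<in> F1_R" "Equal x y \<in> F1_R"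
  "\<phi> \<in> F1_R \<Longrightarrow> Neg \<phi> \<in> F1_R" "\<phi> \<in> F1_R \<Longrightarrow> \<psi> \<in> F1_R \<Longrightarrow> Disj \<phi> \<psi> \<in> F1_R"
  unfolding F1_R_def by (auto intro: F1.intros)

lemma F1_R_Conj [intro]: "\<phi> \<in> F1_R \<Longrightarrow> \<psi> \<in> F1_R \<Longrightarrow> Conj \<phi> \<psi> \<in> F1_R"
  unfolding Conj_def by auto

lemma F1_R_Imp [intro]: "\<phi> \<in> F1_R \<Longrightarrow> \<psi> \<in> F1_R \<Longrightarrow> Imp \<phi> \<psi> \<in> F1_R"
  unfolding Imp_def by auto

lemma F1_R_ConjL [intro]: "(\<And>\<phi>. \<phi> \<in> set \<phi>s \<Longrightarrow> \<phi> \<in> F1_R) \<Longrightarrow> ConjL \<phi>s \<in> F1_R"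
  unfolding ConjL_def by (induction \<phi>s) auto

lemma F1_R_DisjL [intro]: "(\<And>\<phi>. \<phi> \<in> set \<phi>s \<Longrightarrow> \<phi> \<in> F1_R) \<Longrightarrow> DisjL \<phi>s \<in> F1_R"
  unfolding DisjL_def by (induction \<phi>s) auto

lemma F1_R_ExOver [intro]:
  assumes "\<phi> \<in> F1_R"
  shows "ExOver x \<phi> \<in> F1_R"
proof -
  have "Exis (sorted_list_of_set (fv \<phi> - {x})) \<phi> \<in> F1"
    \<comment> \<open>\<open>sorted_list_of_set\<close> enumerates without repetition, and the rule
      exempts one variable whether or not it occurs free.\<close>
    by (rule F1.exi_but_one[of _ x]) (use assms in \<open>auto simp: F1_R_def finite_fv\<close>)
  then show ?thesis using assms by (simp add: F1_R_def ExOver_def)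
qed

lemma F1_R_ExAll [intro]:
  assumes "\<phi> \<in> F1_R"
  shows "ExAll \<phi> \<in> F1_R"
proof -
  obtain x where "x \<notin> fv \<phi>" by (rule obtain_not_fv)
  then show ?thesis using assms by (simp add: ExAll_eq_ExOver F1_R_ExOver)
qed

lemma F1_R_AllC [intro]: "\<phi> \<in> F1_R \<Longrightarrow> AllC \<phi> \<in> F1_R"
  unfolding AllC_def by auto

lemma F1_R_Exi:
  assumes "\<phi> \<in> F1_R" "fv \<phi> \<subseteq> {x, y}" "x \<noteq> y"
  shows "Exi x \<phi> \<in> F1_R"
  using F1.exi_but_one[of \<phi> y "[x]"] assms by (auto simp: F1_R_def)

lemma fv_AllC [simp]: "fv (AllC \<phi>) = {}"
  by (simp add: AllC_def ExAll_def finite_fv)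

section \<open>The axioms of a program\<close>

datatype sym = Obj | Inp | Tag nat | Fact pred

instance sym :: countable
  by countable_datatype

text \<open>First-order variables for a clause instance: \<open>Node i\<close> is the line of its
  \<open>i\<close>-th atom, \<open>Num k\<close> the value of clause variable \<open>k\<close>, and
  \<open>Ptr i j\<close> the pointer from that line to its \<open>j\<close>-th argument.\<close>

datatype var = Node nat | Num nat | Ptr nat nat

instance var :: countable
  by countable_datatype

abbreviation U :: "sym \<Rightarrow> nat \<Rightarrow> fm" where
  "U s x \<equiv> Unary (to_nat s) x"

abbreviation R :: "nat \<Rightarrow> nat \<Rightarrow> fm" where
  "R x y \<equiv> Binary RSym x y"

abbreviation sym_int :: "'a struct \<Rightarrow> sym \<Rightarrow> 'a set" where
  "sym_int M s \<equiv> un_int M (to_nat s)"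

text \<open>\<open>R\<close> already orders the objects, so a line reaches its argument through an
  intermediate element. The pointer stays free: quantifying it here would leave both
  \<open>e\<close> and \<open>a\<close> free, which the fragment forbids.\<close>

definition arg_fm :: "nat \<Rightarrow> nat \<Rightarrow> nat \<Rightarrow> nat \<Rightarrow> fm" where
  "arg_fm e p j a = ConjL [U (Tag j) p, R e p, R p a, U Obj a]"

definition irrefl_ax :: fm where
  "irrefl_ax = Imp (U Obj 0) (Neg (R 0 0))"

definition trans_ax :: fm where
  "trans_ax = Imp (ConjL [U Obj 0, U Obj 1, U Obj 2, R 0 1, R 1 2]) (R 0 2)"

definition total_ax :: fm where
  "total_ax = Imp (Conj (U Obj 0) (U Obj 1)) (DisjL [Equal 0 1, R 0 1, R 1 0])"

text \<open>Without this, the arguments with which a line is justified could differ from those with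
  which another line uses it.\<close>

definition unique_ax :: "nat \<Rightarrow> fm" where
  "unique_ax j = Imp (ConjL [U Obj 0, arg_fm 0 1 j 2, arg_fm 0 3 j 4]) (Equal 2 4)"

text \<open>For the two built-in predicates only soundness is imposed: a line stating such a fact
  must be true in the order, but no such line is forced to exist.\<close>

definition zero_ax :: fm where
  "zero_ax = Imp (ConjL [U Obj 0, U (Fact ZeroP) 0, arg_fm 0 1 0 2, U Obj 3]) (Neg (R 3 2))"

definition succ_ax :: fm where
  "succ_ax = Imp (ConjL [U Obj 0, U (Fact SuccP) 0, arg_fm 0 1 0 2, arg_fm 0 3 1 4, U Obj 5])
     (Conj (R 2 4) (Neg (Conj (R 2 5) (R 5 4))))"

definition atom_fm :: "nat \<Rightarrow> atom \<Rightarrow> fm" where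
  "atom_fm i a = ConjL (U (Fact (fst a)) (to_nat (Node i)) # U Obj (to_nat (Node i)) #
     map (\<lambda>j. arg_fm (to_nat (Node i)) (to_nat (Ptr i j)) j (to_nat (Num (snd a ! j))))
       [0..<length (snd a)])"

text \<open>\<open>Node 0\<close> is the line justified by the clause; the lines of the body are \<open>R\<close>-below it.\<close>

definition clause_fm :: "clause \<Rightarrow> fm" where
  "clause_fm c = ConjL (
     map (\<lambda>i. atom_fm i ((fst c # snd c) ! i)) [0..<Suc (length (snd c))] @
     map (\<lambda>i. R (to_nat (Node i)) (to_nat (Node 0))) [1..<Suc (length (snd c))])"

text \<open>A predicate without clauses yields the empty disjunction, so no line may state
  it.\<close>

definition clause_ax :: "clause list \<Rightarrow> pred \<Rightarrow> fm" where
  "clause_ax Q p = Imp (Conj (U Obj (to_nat (Node 0))) (U (Fact p) (to_nat (Node 0))))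
     (DisjL (map (\<lambda>c. ExOver (to_nat (Node 0)) (clause_fm c)) (filter (\<lambda>c. fst (fst c) = p) Q)))"

text \<open>\<open>Num 0\<close> is the value of the function, forced to be zero by a second line,
  and \<open>Num 1\<close> is its argument. A marker stands for the argument in place of a numeral,
  which keeps the program sentence independent of the input.\<close>

definition goal_fm :: "pred \<Rightarrow> fm" where
  "goal_fm g = ExAll (ConjL [atom_fm 0 (g, [0, 1]), atom_fm 1 (ZeroP, [0]), U Inp (to_nat (Num 1))])"

definition program_fm :: "nat \<Rightarrow> clause list \<Rightarrow> pred list \<Rightarrow> pred \<Rightarrow> fm" where
  "program_fm K Q ps g = AllC (ConjL ([irrefl_ax, trans_ax, total_ax, zero_ax, succ_ax, goal_fm g] @
     map unique_ax [0..<K] @ map (clause_ax Q) ps))"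

lemma arg_fm_F1_R [intro]: "arg_fm e p j a \<in> F1_R"
  unfolding arg_fm_def by (intro F1_R_ConjL) auto

lemma atom_fm_F1_R [intro]: "atom_fm i a \<in> F1_R"
  unfolding atom_fm_def by (intro F1_R_ConjL) auto

lemma order_axs_F1_R: "irrefl_ax \<in> F1_R" "trans_ax \<in> F1_R" "total_ax \<in> F1_R"
  unfolding irrefl_ax_def trans_ax_def total_ax_def
  by (auto intro!: F1_R_Imp F1_R_Conj F1_R_ConjL F1_R_DisjL)

lemma unique_ax_F1_R: "unique_ax j \<in> F1_R"
  unfolding unique_ax_def by (intro F1_R_Imp F1_R_ConjL F1_R_basic) auto

lemma zero_ax_F1_R: "zero_ax \<in> F1_R"
  unfolding zero_ax_def by (intro F1_R_Imp F1_R_ConjL F1_R_basic) auto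

lemma succ_ax_F1_R: "succ_ax \<in> F1_R"
  unfolding succ_ax_def by (intro F1_R_Imp F1_R_Conj F1_R_ConjL F1_R_basic) auto

lemma clause_ax_F1_R: "clause_ax Q p \<in> F1_R"
proof -
  have "clause_fm c \<in> F1_R" for c
    unfolding clause_fm_def by (intro F1_R_ConjL) (auto simp del: upt_Suc)
  then show ?thesis
    unfolding clause_ax_def
    by (intro F1_R_Imp F1_R_Conj F1_R_DisjL F1_R_basic) (auto simp: F1_R_ExOver)
qed

lemma goal_fm_F1_R: "goal_fm g \<in> F1_R"
  unfolding goal_fm_def by (intro F1_R_ExAll F1_R_ConjL) auto

lemma program_fm_F1_R: "program_fm K Q ps g \<in> F1_R"
  unfolding program_fm_def
  by (intro F1_R_AllC F1_R_ConjL)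
    (auto simp: order_axs_F1_R unique_ax_F1_R zero_ax_F1_R succ_ax_F1_R clause_ax_F1_R goal_fm_F1_R)

section \<open>The semantic content of the axioms\<close>

definition is_arg :: "'a struct \<Rightarrow> 'a \<Rightarrow> nat \<Rightarrow> 'a \<Rightarrow> bool" where
  "is_arg M e j a \<longleftrightarrow> (\<exists>p \<in> univ M. p \<in> sym_int M (Tag j) \<and> (e, p) \<in> bin_int M RSym \<and>
     (p, a) \<in> bin_int M RSym \<and> a \<in> sym_int M Obj)"

definition holds :: "'a struct \<Rightarrow> (nat \<Rightarrow> 'a) \<Rightarrow> 'a \<Rightarrow> atom \<Rightarrow> bool" where
  "holds M \<nu> e a \<longleftrightarrow> e \<in> sym_int M (Fact (fst a)) \<and> e \<in> sym_int M Obj \<and>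
     (\<forall>j < length (snd a). is_arg M e j (\<nu> (snd a ! j)))"

text \<open>The program sentence with the syntax removed: valuations of \<open>Num\<close> and
  \<open>Node\<close> become \<open>\<nu>\<close> and \<open>ns\<close>, and the pointers disappear
  into \<open>is_arg\<close>. Both directions of the reduction work with this form.\<close>

locale program_model =
  fixes M :: "'a struct" and K :: nat and Q :: "clause list" and ps :: "pred list" and g :: pred
  assumes irrefl: "a \<in> sym_int M Obj \<Longrightarrow> (a, a) \<notin> bin_int M RSym"
    and trans: "a \<in> sym_int M Obj \<Longrightarrow> b \<in> sym_int M Obj \<Longrightarrow> c \<in> sym_int M Obj \<Longrightarrow>
      (a, b) \<in> bin_int M RSym \<Longrightarrow> (b, c) \<in> bin_int M RSym \<Longrightarrow> (a, c) \<in> bin_int M RSym"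
    and total: "a \<in> sym_int M Obj \<Longrightarrow> b \<in> sym_int M Obj \<Longrightarrow>
      a = b \<or> (a, b) \<in> bin_int M RSym \<or> (b, a) \<in> bin_int M RSym"
    and unique: "e \<in> sym_int M Obj \<Longrightarrow> j < K \<Longrightarrow> is_arg M e j a \<Longrightarrow> is_arg M e j b \<Longrightarrow> a = b"
    and zero: "e \<in> sym_int M Obj \<Longrightarrow> e \<in> sym_int M (Fact ZeroP) \<Longrightarrow> is_arg M e 0 a \<Longrightarrow>
      c \<in> sym_int M Obj \<Longrightarrow> (c, a) \<notin> bin_int M RSym"
    and succ: "e \<in> sym_int M Obj \<Longrightarrow> e \<in> sym_int M (Fact SuccP) \<Longrightarrow> is_arg M e 0 a \<Longrightarrow>
      is_arg M e 1 b \<Longrightarrow> (a, b) \<in> bin_int M RSym \<and>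
        \<not> (\<exists>c \<in> sym_int M Obj. (a, c) \<in> bin_int M RSym \<and> (c, b) \<in> bin_int M RSym)"
    and clause: "p \<in> set ps \<Longrightarrow> e \<in> sym_int M Obj \<Longrightarrow> e \<in> sym_int M (Fact p) \<Longrightarrow>
      \<exists>c \<in> set Q. \<exists>\<nu> ns. fst (fst c) = p \<and> range \<nu> \<subseteq> univ M \<and> range ns \<subseteq> univ M \<and> ns 0 = e \<and>
        (\<forall>i \<le> length (snd c). holds M \<nu> (ns i) ((fst c # snd c) ! i)) \<and>
        (\<forall>i \<in> {1..length (snd c)}. (ns i, e) \<in> bin_int M RSym)"
    and goal: "\<exists>\<nu> e z. range \<nu> \<subseteq> univ M \<and> holds M \<nu> e (g, [0, 1]) \<and> holds M \<nu> z (ZeroP, [0]) \<and>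
      \<nu> 1 \<in> sym_int M Inp"

lemma sat_arg_fm [simp]:
  "sat M v (arg_fm e p j a) \<longleftrightarrow> v p \<in> sym_int M (Tag j) \<and> (v e, v p) \<in> bin_int M RSym \<and>
     (v p, v a) \<in> bin_int M RSym \<and> v a \<in> sym_int M Obj"
  by (auto simp: arg_fm_def)

lemma sat_atom_fm:
  "range v \<subseteq> univ M \<Longrightarrow> sat M v (atom_fm i a) \<Longrightarrow>
     holds M (\<lambda>x. v (to_nat (Num x))) (v (to_nat (Node i))) a"
  unfolding atom_fm_def holds_def is_arg_def
  by (force simp: image_subset_iff)

text \<open>The choice stays in the universe even when there is no such argument, because valuations
  must take values there.\<close>

definition the_ptr :: "'a struct \<Rightarrow> 'a \<Rightarrow> nat \<Rightarrow> 'a \<Rightarrow> 'a" where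
  "the_ptr M e j a = (SOME p. p \<in> univ M \<and> (is_arg M e j a \<longrightarrow> p \<in> sym_int M (Tag j) \<and>
     (e, p) \<in> bin_int M RSym \<and> (p, a) \<in> bin_int M RSym \<and> a \<in> sym_int M Obj))"

lemma the_ptr:
  assumes "univ M \<noteq> {}"
  shows "the_ptr M e j a \<in> univ M \<and> (is_arg M e j a \<longrightarrow> the_ptr M e j a \<in> sym_int M (Tag j) \<and>
     (e, the_ptr M e j a) \<in> bin_int M RSym \<and> (the_ptr M e j a, a) \<in> bin_int M RSym \<and>
     a \<in> sym_int M Obj)"
  unfolding the_ptr_def by (rule someI_ex) (use assms in \<open>auto simp: is_arg_def\<close>)

text \<open>Assembles the single valuation demanded by the formulas from \<open>\<nu>\<close>,
  \<open>ns\<close> and chosen pointers.\<close>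

definition atoms_val :: "'a struct \<Rightarrow> (nat \<Rightarrow> 'a) \<Rightarrow> (nat \<Rightarrow> 'a) \<Rightarrow> atom list \<Rightarrow> nat \<Rightarrow> 'a" where
  "atoms_val M \<nu> ns as x = (case from_nat x of Node i \<Rightarrow> ns i | Num i \<Rightarrow> \<nu> i
     | Ptr i j \<Rightarrow> the_ptr M (ns i) j (\<nu> (snd (as ! i) ! j)))"

lemma atoms_val_simps [simp]:
  "atoms_val M \<nu> ns as (to_nat (Node i)) = ns i"
  "atoms_val M \<nu> ns as (to_nat (Num k)) = \<nu> k"
  "atoms_val M \<nu> ns as (to_nat (Ptr i j)) = the_ptr M (ns i) j (\<nu> (snd (as ! i) ! j))"
  by (simp_all add: atoms_val_def)

lemma range_atoms_val:
  "univ M \<noteq> {} \<Longrightarrow> range \<nu> \<subseteq> univ M \<Longrightarrow> range ns \<subseteq> univ M \<Longrightarrow> range (atoms_val M \<nu> ns as) \<subseteq> univ M"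
  by (simp add: atoms_val_def the_ptr image_subset_iff split: var.split)

lemma sat_atoms_val:
  assumes "univ M \<noteq> {}" "holds M \<nu> (ns i) (as ! i)" "a = as ! i"
  shows "sat M (atoms_val M \<nu> ns as) (atom_fm i a)"
  using assms(2) the_ptr[OF assms(1)] by (auto simp: atom_fm_def holds_def assms(3))

text \<open>Variables from 5 on share the default \<open>f\<close>, through which
  \<open>succ_ax\<close> receives its sixth variable.\<close>

lemma models_instance:
  assumes "models M \<phi>" "{a, b, c, d, e, f} \<subseteq> univ M"
  shows "sat M ((\<lambda>_. f)(0 := a, 1 := b, 2 := c, 3 := d, 4 := e)) \<phi>"
  using assms unfolding models_def by (elim allE impE) auto

lemma is_argE:
  assumes "is_arg M e j a"
  obtains p where "p \<in> univ M" "p \<in> sym_int M (Tag j)" "(e, p) \<in> bin_int M RSym"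
    "(p, a) \<in> bin_int M RSym" "a \<in> sym_int M Obj"
  using assms unfolding is_arg_def by blast

lemma models_clause_ax:
  assumes "univ M \<noteq> {}"
  shows "models M (clause_ax Q p) \<longleftrightarrow>
    (\<forall>e \<in> univ M. e \<in> sym_int M Obj \<longrightarrow> e \<in> sym_int M (Fact p) \<longrightarrow>
      (\<exists>c \<in> set Q. fst (fst c) = p \<and>
        (\<exists>w. range w \<subseteq> univ M \<and> w (to_nat (Node 0)) = e \<and> sat M w (clause_fm c))))"
    (is "_ \<longleftrightarrow> (\<forall>e \<in> univ M. ?P e)")
proof -
  have P: "sat M v (clause_ax Q p) \<longleftrightarrow> ?P (v (to_nat (Node 0)))" if v: "range v \<subseteq> univ M" for v
  proof -
    have *: "(\<exists>\<phi> \<in> set (map F (filter S Q)). sat M v \<phi>) \<longleftrightarrow> (\<exists>c \<in> set Q. S c \<and> sat M v (F c))" for F S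
      by auto
    show ?thesis
      unfolding clause_ax_def sat_Imp sat_Conj sat_DisjL * sat.simps(1) sat_ExOver[OF v] imp_conjL
      by (rule refl)
  qed
  show ?thesis
  proof
    assume L: "models M (clause_ax Q p)"
    show "\<forall>e \<in> univ M. ?P e"
    proof
      fix e assume "e \<in> univ M"
      then have v: "range (\<lambda>_::nat. e) \<subseteq> univ M" by auto
      with L have "sat M (\<lambda>_. e) (clause_ax Q p)" unfolding models_def by blast
      then show "?P e" unfolding P[OF v] .
    qed
  next
    assume R: "\<forall>e \<in> univ M. ?P e"
    show "models M (clause_ax Q p)"
      unfolding models_def
    proof (intro allI impI)
      fix v :: "nat \<Rightarrow> 'a" assume v: "range v \<subseteq> univ M"
      then have "v (to_nat (Node 0)) \<in> univ M" by auto
      with R show "sat M v (clause_ax Q p)" unfolding P[OF v] by (rule bspec)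
    qed
  qed
qed

lemma models_order_axs:
  assumes un: "\<And>P. un_int M P \<subseteq> univ M"
  shows "models M irrefl_ax \<Longrightarrow> a \<in> sym_int M Obj \<Longrightarrow> (a, a) \<notin> bin_int M RSym"
    "models M trans_ax \<Longrightarrow> a \<in> sym_int M Obj \<Longrightarrow> b \<in> sym_int M Obj \<Longrightarrow> c \<in> sym_int M Obj \<Longrightarrow>
      (a, b) \<in> bin_int M RSym \<Longrightarrow> (b, c) \<in> bin_int M RSym \<Longrightarrow> (a, c) \<in> bin_int M RSym"
    "models M total_ax \<Longrightarrow> a \<in> sym_int M Obj \<Longrightarrow> b \<in> sym_int M Obj \<Longrightarrow>
      a = b \<or> (a, b) \<in> bin_int M RSym \<or> (b, a) \<in> bin_int M RSym"
proof -
  note U = subsetD[OF un]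
  show "models M irrefl_ax \<Longrightarrow> a \<in> sym_int M Obj \<Longrightarrow> (a, a) \<notin> bin_int M RSym"
    using models_instance[of M irrefl_ax a a a a a a] by (simp add: irrefl_ax_def U)
  show "models M trans_ax \<Longrightarrow> a \<in> sym_int M Obj \<Longrightarrow> b \<in> sym_int M Obj \<Longrightarrow> c \<in> sym_int M Obj \<Longrightarrow>
      (a, b) \<in> bin_int M RSym \<Longrightarrow> (b, c) \<in> bin_int M RSym \<Longrightarrow> (a, c) \<in> bin_int M RSym"
    using models_instance[of M trans_ax a b c a a a] by (simp add: trans_ax_def U)
  show "models M total_ax \<Longrightarrow> a \<in> sym_int M Obj \<Longrightarrow> b \<in> sym_int M Obj \<Longrightarrow>
      a = b \<or> (a, b) \<in> bin_int M RSym \<or> (b, a) \<in> bin_int M RSym"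
    using models_instance[of M total_ax a b a a a a] by (simp add: total_ax_def U)
qed

lemma models_unique_ax:
  assumes un: "\<And>P. un_int M P \<subseteq> univ M" and ax: "models M (unique_ax j)"
    and e: "e \<in> sym_int M Obj" "is_arg M e j a" "is_arg M e j b"
  shows "a = b"
proof -
  note U = subsetD[OF un]
  from e(2) obtain p where p: "p \<in> univ M" "p \<in> sym_int M (Tag j)" "(e, p) \<in> bin_int M RSym"
    "(p, a) \<in> bin_int M RSym" "a \<in> sym_int M Obj" by (rule is_argE)
  from e(3) obtain q where q: "q \<in> univ M" "q \<in> sym_int M (Tag j)" "(e, q) \<in> bin_int M RSym"
    "(q, b) \<in> bin_int M RSym" "b \<in> sym_int M Obj" by (rule is_argE)
  show "a = b" using models_instance[OF ax, of e p a q b e] e(1) p q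
    by (simp add: unique_ax_def U)
qed

lemma models_zero_ax:
  assumes un: "\<And>P. un_int M P \<subseteq> univ M" and ax: "models M zero_ax"
    and e: "e \<in> sym_int M Obj" "e \<in> sym_int M (Fact ZeroP)" "is_arg M e 0 a" "c \<in> sym_int M Obj"
  shows "(c, a) \<notin> bin_int M RSym"
proof -
  note U = subsetD[OF un]
  from e(3) obtain p where p: "p \<in> univ M" "p \<in> sym_int M (Tag 0)" "(e, p) \<in> bin_int M RSym"
    "(p, a) \<in> bin_int M RSym" "a \<in> sym_int M Obj" by (rule is_argE)
  show "(c, a) \<notin> bin_int M RSym" using models_instance[OF ax, of e p a c e e] e p
    by (simp add: zero_ax_def U)
qed

lemma models_succ_ax:
  assumes un: "\<And>P. un_int M P \<subseteq> univ M" and ax: "models M succ_ax"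
    and e: "e \<in> sym_int M Obj" "e \<in> sym_int M (Fact SuccP)" "is_arg M e 0 a" "is_arg M e 1 b"
      "c \<in> sym_int M Obj"
  shows "(a, b) \<in> bin_int M RSym \<and> \<not> ((a, c) \<in> bin_int M RSym \<and> (c, b) \<in> bin_int M RSym)"
proof -
  note U = subsetD[OF un]
  from e(3) obtain p where p: "p \<in> univ M" "p \<in> sym_int M (Tag 0)" "(e, p) \<in> bin_int M RSym"
    "(p, a) \<in> bin_int M RSym" "a \<in> sym_int M Obj" by (rule is_argE)
  from e(4) obtain q where q: "q \<in> univ M" "q \<in> sym_int M (Tag 1)" "(e, q) \<in> bin_int M RSym"
    "(q, b) \<in> bin_int M RSym" "b \<in> sym_int M Obj" by (rule is_argE)
  show ?thesis using models_instance[OF ax, of e p a q b c] e p q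
    by (simp add: succ_ax_def U)
qed

lemma program_model_if_models:
  assumes ne: "univ M \<noteq> {}" and un: "\<And>P. un_int M P \<subseteq> univ M"
    and M: "models M (program_fm K Q ps g)"
  shows "program_model M K Q ps g"
proof -
  have axs: "models M irrefl_ax" "models M trans_ax" "models M total_ax" "models M zero_ax"
    "models M succ_ax" "models M (goal_fm g)" "\<And>j. j < K \<Longrightarrow> models M (unique_ax j)"
    "\<And>p. p \<in> set ps \<Longrightarrow> models M (clause_ax Q p)"
    using M unfolding program_fm_def models_AllC[OF ne] by simp_all
  show ?thesis
  proof
    fix p e assume p: "p \<in> set ps" and e: "e \<in> sym_int M Obj" "e \<in> sym_int M (Fact p)"
    then have "e \<in> univ M" using un by blast
    then obtain c w where c: "c \<in> set Q" "fst (fst c) = p" and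
      w: "range w \<subseteq> univ M" "w (to_nat (Node 0)) = e" "sat M w (clause_fm c)"
      using axs(8)[OF p, unfolded models_clause_ax[OF ne]] e by blast
    \<comment> \<open>The witnesses are the restrictions of \<open>w\<close> to the variables
      \<open>Num\<close> and \<open>Node\<close>.\<close>
    have "holds M (\<lambda>x. w (to_nat (Num x))) (w (to_nat (Node i))) ((fst c # snd c) ! i)"
      if "i \<le> length (snd c)" for i
    proof (rule sat_atom_fm[OF w(1)])
      show "sat M w (atom_fm i ((fst c # snd c) ! i))"
        using w(3) that by (simp add: clause_fm_def ball_Un del: upt_Suc)
    qed
    moreover have "(w (to_nat (Node i)), e) \<in> bin_int M RSym" if "i \<in> {1..length (snd c)}" for i
      using w(2,3) that by (simp add: clause_fm_def ball_Un del: upt_Suc)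
    moreover have "range (\<lambda>x. w (to_nat (Num x))) \<subseteq> univ M" "range (\<lambda>x. w (to_nat (Node x))) \<subseteq> univ M"
      using w(1) by auto
    ultimately show "\<exists>c \<in> set Q. \<exists>\<nu> ns. fst (fst c) = p \<and> range \<nu> \<subseteq> univ M \<and> range ns \<subseteq> univ M \<and> ns 0 = e \<and>
        (\<forall>i \<le> length (snd c). holds M \<nu> (ns i) ((fst c # snd c) ! i)) \<and>
        (\<forall>i \<in> {1..length (snd c)}. (ns i, e) \<in> bin_int M RSym)"
      using c w(2) by (intro bexI[of _ c] exI[of _ "\<lambda>x. w (to_nat (Num x))"]
         exI[of _ "\<lambda>x. w (to_nat (Node x))"]) simp_all
  next
    from axs(6) obtain w where w: "range w \<subseteq> univ M" "sat M w (atom_fm 0 (g, [0, 1]))"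
      "sat M w (atom_fm 1 (ZeroP, [0]))" "w (to_nat (Num 1)) \<in> sym_int M Inp"
      unfolding goal_fm_def models_ExAll[OF ne] by auto
    have "range (\<lambda>x. w (to_nat (Num x))) \<subseteq> univ M" using w(1) by auto
    then show "\<exists>\<nu> e z. range \<nu> \<subseteq> univ M \<and> holds M \<nu> e (g, [0, 1]) \<and> holds M \<nu> z (ZeroP, [0]) \<and>
      \<nu> 1 \<in> sym_int M Inp"
      using sat_atom_fm[OF w(1,2)] sat_atom_fm[OF w(1,3)] w(4) by blast
  next
    fix e a b assume "e \<in> sym_int M Obj" "e \<in> sym_int M (Fact SuccP)" "is_arg M e 0 a" "is_arg M e 1 b"
    note * = models_succ_ax[OF un axs(5) this]
    show "(a, b) \<in> bin_int M RSym \<and>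
        \<not> (\<exists>c \<in> sym_int M Obj. (a, c) \<in> bin_int M RSym \<and> (c, b) \<in> bin_int M RSym)"
      using *[OF \<open>e \<in> sym_int M Obj\<close>] * by blast
  qed (use models_order_axs[OF un] models_unique_ax[OF un] models_zero_ax[OF un] axs in \<open>blast+\<close>)
qed

lemma (in program_model) models_program_fm:
  assumes ne: "univ M \<noteq> {}" and un: "\<And>P. un_int M P \<subseteq> univ M"
  shows "models M (program_fm K Q ps g)"
proof -
  have arg: "is_arg M (v e) j (v a)" if "range v \<subseteq> univ M" "sat M v (arg_fm e p j a)" for v e p j a
    using that unfolding is_arg_def by auto
  have "models M irrefl_ax" "models M trans_ax" "models M total_ax"
    using irrefl trans total by (auto simp: irrefl_ax_def trans_ax_def total_ax_def models_def)
  moreover have "models M (unique_ax j)" if "j < K" for j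
    unfolding models_def
  proof (intro allI impI)
    fix v :: "nat \<Rightarrow> 'a" assume "range v \<subseteq> univ M"
    note arg = arg[OF this]
    show "sat M v (unique_ax j)"
      using unique[OF _ that, of "v 0" "v 2" "v 4"] arg[of 0 1 j 2] arg[of 0 3 j 4]
      unfolding unique_ax_def sat_Imp sat_Conj sat_ConjL sat.simps list.set ball_simps by blast
  qed
  moreover have "models M zero_ax"
    unfolding models_def
  proof (intro allI impI)
    fix v :: "nat \<Rightarrow> 'a" assume "range v \<subseteq> univ M"
    note arg = arg[OF this]
    show "sat M v zero_ax"
      using zero[of "v 0" "v 2" "v 3"] arg[of 0 1 0 2]
      unfolding zero_ax_def sat_Imp sat_Conj sat_ConjL sat.simps list.set ball_simps by blast
  qed
  moreover have "models M succ_ax"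
    unfolding models_def
  proof (intro allI impI)
    fix v :: "nat \<Rightarrow> 'a" assume "range v \<subseteq> univ M"
    note arg = arg[OF this]
    show "sat M v succ_ax"
      using succ[of "v 0" "v 2" "v 4"] arg[of 0 1 0 2] arg[of 0 3 1 4]
      unfolding succ_ax_def sat_Imp sat_Conj sat_ConjL sat.simps list.set ball_simps by blast
  qed
  moreover have "models M (clause_ax Q p)" if p: "p \<in> set ps" for p
    unfolding models_clause_ax[OF ne]
  proof (intro ballI impI)
    fix e assume e: "e \<in> sym_int M Obj" "e \<in> sym_int M (Fact p)"
    from clause[OF p e] obtain c \<nu> ns where c: "c \<in> set Q" "fst (fst c) = p" and
      r: "range \<nu> \<subseteq> univ M" "range ns \<subseteq> univ M" and ns: "ns 0 = e"
      "\<forall>i \<le> length (snd c). holds M \<nu> (ns i) ((fst c # snd c) ! i)"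
      "\<forall>i \<in> {1..length (snd c)}. (ns i, e) \<in> bin_int M RSym" by blast
    let ?w = "atoms_val M \<nu> ns (fst c # snd c)"
    have "sat M ?w (clause_fm c)"
      using ns by (simp add: clause_fm_def ball_Un sat_atoms_val[OF ne] del: upt_Suc)
    then show "\<exists>c \<in> set Q. fst (fst c) = p \<and>
        (\<exists>w. range w \<subseteq> univ M \<and> w (to_nat (Node 0)) = e \<and> sat M w (clause_fm c))"
      using c ns(1) range_atoms_val[OF ne r] by (intro bexI[of _ c] conjI exI[of _ ?w]) simp_all
  qed
  moreover have "models M (goal_fm g)"
  proof -
    from goal obtain \<nu> e z where r: "range \<nu> \<subseteq> univ M" and h: "holds M \<nu> e (g, [0, 1])"
      "holds M \<nu> z (ZeroP, [0])" "\<nu> 1 \<in> sym_int M Inp" by blast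
    let ?ns = "\<lambda>i. if i = (0::nat) then e else z" and ?as = "[(g, [0, 1]), (ZeroP, [0])]"
    have "range ?ns \<subseteq> univ M" using un h unfolding holds_def by auto
    moreover have "sat M (atoms_val M \<nu> ?ns ?as) (atom_fm 0 (g, [0, 1]))"
      "sat M (atoms_val M \<nu> ?ns ?as) (atom_fm 1 (ZeroP, [0]))"
      using h by (simp_all add: sat_atoms_val[OF ne])
    ultimately show ?thesis
      unfolding goal_fm_def models_ExAll[OF ne]
      using range_atoms_val[OF ne r] h(3) by (intro exI[of _ "atoms_val M \<nu> ?ns ?as"]) simp
  qed
  ultimately show "models M (program_fm K Q ps g)"
    unfolding program_fm_def models_AllC[OF ne] by auto
qed

section \<open>From models to derivations\<close>

definition rank :: "'a struct \<Rightarrow> 'a \<Rightarrow> nat" where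
  "rank M x = card {c \<in> sym_int M Obj. (c, x) \<in> bin_int M RSym}"

text \<open>Passes from "rank at least n" to "rank at least n + 1" by asking for an object below.
  The inner quantifier moves variable 1 into variable 0, so two variables suffice for every
  \<open>n\<close>, each quantifier leaves at most one variable free, and the code of the result is
  obtained by iteration.\<close>

definition rank_step :: "fm \<Rightarrow> fm" where
  "rank_step \<phi> = Exi 1 (Conj (Conj (U Obj 1) (R 1 0)) (Exi 0 (Conj (Equal 0 1) \<phi>)))"

definition rank_ge_fm :: "nat \<Rightarrow> fm" where
  "rank_ge_fm n = (rank_step ^^ n) (Equal 0 0)"

text \<open>Rank exactly n is expressed as at least n and not at least n + 1. Existence of a marked
  object is the business of \<open>goal_fm\<close>.\<close>

definition input_fm :: "nat \<Rightarrow> fm" where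
  "input_fm n = Neg (Exi 0 (Conj (U Inp 0) (Neg (Conj (rank_ge_fm n) (Neg (rank_ge_fm (Suc n)))))))"

lemma fv_Conj [simp]: "fv (Conj \<phi> \<psi>) = fv \<phi> \<union> fv \<psi>"
  by (simp add: Conj_def)

lemma fv_rank_ge_fm: "fv (rank_ge_fm n) \<subseteq> {0}"
  unfolding rank_ge_fm_def by (induction n) (auto simp: rank_step_def)

lemma fv_input_fm: "fv (input_fm n) = {}"
  using fv_rank_ge_fm[of n] fv_rank_ge_fm[of "Suc n"] by (auto simp: input_fm_def)

lemma rank_ge_fm_F1_R: "rank_ge_fm n \<in> F1_R"
proof (induction n)
  case (Suc n)
  have "Exi 0 (Conj (Equal 0 1) (rank_ge_fm n)) \<in> F1_R"
  proof (rule F1_R_Exi[where y = 1])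
    show "Conj (Equal 0 1) (rank_ge_fm n) \<in> F1_R" by (intro F1_R_Conj F1_R_basic Suc)
  qed (use fv_rank_ge_fm[of n] in auto)
  moreover have "fv (Exi 0 (Conj (Equal 0 1) (rank_ge_fm n))) \<subseteq> {1, 0}"
    using fv_rank_ge_fm[of n] by auto
  ultimately have "rank_step (rank_ge_fm n) \<in> F1_R"
    unfolding rank_step_def
    by (intro F1_R_Exi[where x = 1 and y = 0] F1_R_Conj F1_R_basic) (simp_all del: fv.simps(6))
  then show ?case by (simp add: rank_ge_fm_def)
qed (auto simp: rank_ge_fm_def)

lemma input_fm_F1_R: "input_fm n \<in> F1_R"
proof -
  have "fv (rank_ge_fm n) \<subseteq> {0, 1}" "fv (rank_ge_fm (Suc n)) \<subseteq> {0, 1}"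
    using fv_rank_ge_fm by blast+
  then have "Exi 0 (Conj (U Inp 0) (Neg (Conj (rank_ge_fm n) (Neg (rank_ge_fm (Suc n)))))) \<in> F1_R"
    by (intro F1_R_Exi[where y = 1] F1_R_Conj F1_R_basic rank_ge_fm_F1_R) simp_all
  then show ?thesis unfolding input_fm_def by (rule F1_R_basic)
qed

context program_model
begin

text \<open>By transitivity the segment below \<open>b\<close> contains the one below
  \<open>a\<close>, and \<open>a\<close> itself is a new member by irreflexivity.\<close>

lemma rank_less:
  assumes "finite (sym_int M Obj)" "a \<in> sym_int M Obj" "b \<in> sym_int M Obj" "(a, b) \<in> bin_int M RSym"
  shows "rank M a < rank M b"
  unfolding rank_def
proof (rule psubset_card_mono)
  show "finite {c \<in> sym_int M Obj. (c, b) \<in> bin_int M RSym}" using assms(1) by simp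
  show "{c \<in> sym_int M Obj. (c, a) \<in> bin_int M RSym} \<subset> {c \<in> sym_int M Obj. (c, b) \<in> bin_int M RSym}"
    using assms(2-4) irrefl[of a] trans[of _ a b] by blast
qed

text \<open>Pigeonhole: there are \<open>rank M a\<close> many objects below \<open>a\<close>, their
  ranks are distinct by totality and smaller than \<open>rank M a\<close>, so every smaller number
  is attained.\<close>

lemma ex_rank_eq:
  assumes fin: "finite (sym_int M Obj)" and a: "a \<in> sym_int M Obj" "m < rank M a"
  shows "\<exists>b \<in> sym_int M Obj. (b, a) \<in> bin_int M RSym \<and> rank M b = m"
proof -
  let ?S = "{c \<in> sym_int M Obj. (c, a) \<in> bin_int M RSym}"
  have "inj_on (rank M) ?S"
  proof (rule inj_onI)
    fix x y assume "x \<in> ?S" "y \<in> ?S" "rank M x = rank M y"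
    then show "x = y" using total[of x y] rank_less[OF fin, of x y] rank_less[OF fin, of y x] by auto
  qed
  then have "card (rank M ` ?S) = rank M a" by (simp add: card_image rank_def[of M a])
  moreover have "rank M ` ?S \<subseteq> {..<rank M a}" using rank_less[OF fin] a(1) by auto
  ultimately have "rank M ` ?S = {..<rank M a}" by (intro card_subset_eq) auto
  with a(2) show ?thesis by (metis (no_types, lifting) imageE lessThan_iff mem_Collect_eq)
qed

lemma sat_rank_ge_fm:
  assumes fin: "finite (sym_int M Obj)" and un: "sym_int M Obj \<subseteq> univ M"
  shows "v 0 \<in> sym_int M Obj \<Longrightarrow> sat M v (rank_ge_fm n) \<longleftrightarrow> n \<le> rank M (v 0)"
proof (induction n arbitrary: v)
  case 0
  then show ?case by (simp add: rank_ge_fm_def)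
next
  case (Suc n)
  have "sat M v (rank_ge_fm (Suc n)) \<longleftrightarrow> sat M v (rank_step (rank_ge_fm n))"
    by (simp add: rank_ge_fm_def)
  also have "\<dots> \<longleftrightarrow> (\<exists>b \<in> sym_int M Obj. (b, v 0) \<in> bin_int M RSym \<and>
      sat M (v(1 := b, 0 := b)) (rank_ge_fm n))"
    using un by (auto simp: rank_step_def)
  also have "\<dots> \<longleftrightarrow> (\<exists>b \<in> sym_int M Obj. (b, v 0) \<in> bin_int M RSym \<and> n \<le> rank M b)"
  proof (intro bex_cong conj_cong refl)
    fix b assume "b \<in> sym_int M Obj"
    then show "sat M (v(1 := b, 0 := b)) (rank_ge_fm n) \<longleftrightarrow> n \<le> rank M b"
      using Suc.IH[of "v(1 := b, 0 := b)", unfolded fun_upd_same] by blast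
  qed
  \<comment> \<open>From left to right ranks increase along \<open>R\<close>; conversely some object
    below has rank exactly \<open>n\<close>.\<close>
  also have "\<dots> \<longleftrightarrow> Suc n \<le> rank M (v 0)"
    using ex_rank_eq[OF fin Suc.prems, of n] rank_less[OF fin _ Suc.prems] by fastforce
  finally show ?case .
qed

lemma models_input_fm:
  assumes "univ M \<noteq> {}" "finite (sym_int M Obj)" "sym_int M Obj \<subseteq> univ M"
    and "sym_int M Inp \<subseteq> sym_int M Obj"
    and "\<And>x. x \<in> sym_int M Inp \<Longrightarrow> rank M x = n"
  shows "models M (input_fm n)"
proof -
  have "sat M v (rank_ge_fm n) \<and> \<not> sat M v (rank_ge_fm (Suc n))" if "v 0 \<in> sym_int M Inp" for v
  proof -
    have "v 0 \<in> sym_int M Obj" "rank M (v 0) = n" using that assms(4,5) by auto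
    then show ?thesis by (simp add: sat_rank_ge_fm[OF assms(2,3)])
  qed
  then show ?thesis by (simp add: models_def input_fm_def)
qed

lemma rank_input:
  assumes "finite (sym_int M Obj)" "sym_int M Obj \<subseteq> univ M" "models M (input_fm n)"
    and x: "x \<in> sym_int M Obj" "x \<in> sym_int M Inp"
  shows "rank M x = n"
proof -
  have "x \<in> univ M" using x assms(2) by blast
  then have "range (\<lambda>_::nat. x) \<subseteq> univ M" by auto
  then have "sat M (\<lambda>_. x) (input_fm n)" using assms(3) unfolding models_def by blast
  then have "sat M ((\<lambda>_. x)(0 := x)) (rank_ge_fm n) \<and> \<not> sat M ((\<lambda>_. x)(0 := x)) (rank_ge_fm (Suc n))"
    using x \<open>x \<in> univ M\<close> by (auto simp: input_fm_def)
  then show ?thesis by (simp add: sat_rank_ge_fm[OF assms(1,2)] x)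
qed

text \<open>The body lines of a justification lie strictly \<open>R\<close>-below its head line, so
  induction on the rank of the line excludes circular justifications. Every argument is read as its
  rank.\<close>

lemma derivable_if_fact:
  assumes fin: "finite (sym_int M Obj)"
    and Q: "set Q \<subseteq> rec_clauses" and K: "\<And>c. c \<in> set Q \<Longrightarrow> arity (fst (fst c)) \<le> K"
    and ps: "\<And>c a. c \<in> set Q \<Longrightarrow> a \<in> set (snd c) \<Longrightarrow> fst a \<in> set ps \<union> {ZeroP, SuccP}"
  shows "e \<in> sym_int M Obj \<Longrightarrow> e \<in> sym_int M (Fact p) \<Longrightarrow> p \<in> set ps \<union> {ZeroP, SuccP} \<Longrightarrow>
    length xs = arity p \<Longrightarrow> (\<And>j. j < arity p \<Longrightarrow> is_arg M e j (xs ! j)) \<Longrightarrow>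
    derivable (set Q) p (map (rank M) xs)"
proof (induction "rank M e" arbitrary: e p xs rule: less_induct)
  case less
  have Obj: "x \<in> sym_int M Obj" if "is_arg M y j x" for x y j
    using that unfolding is_arg_def by blast
  from less.prems(3) consider "p = ZeroP" | "p = SuccP" | "p \<in> set ps" by blast
  then show ?case
  proof cases
    case 1
    with less.prems(4) obtain a where a: "xs = [a]" by (auto simp: length_Suc_conv)
    with 1 less.prems(5)[of 0] have arg: "is_arg M e 0 a" by simp
    have "rank M a = 0"
    proof (rule ccontr)
      assume "rank M a \<noteq> 0"
      then obtain b where "b \<in> sym_int M Obj" "(b, a) \<in> bin_int M RSym"
        using ex_rank_eq[OF fin Obj[OF arg], of 0] by auto
      then show False using zero[OF less.prems(1) _ arg] less.prems(2) 1 by blast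
    qed
    then show ?thesis using a 1 derivable.zero by simp
  next
    case 2
    with less.prems(4) obtain a b where a: "xs = [a, b]"
      by (auto simp: length_Suc_conv numeral_2_eq_2)
    with 2 less.prems(5)[of 0] less.prems(5)[of 1]
    have arg: "is_arg M e 0 a" "is_arg M e 1 b" by simp_all
    have ab: "(a, b) \<in> bin_int M RSym" and
      no: "\<And>c. c \<in> sym_int M Obj \<Longrightarrow> (a, c) \<in> bin_int M RSym \<Longrightarrow> (c, b) \<notin> bin_int M RSym"
      using succ[OF less.prems(1) _ arg] less.prems(2) 2 by blast+
    have lt: "rank M a < rank M b" by (rule rank_less[OF fin Obj[OF arg(1)] Obj[OF arg(2)] ab])
    \<comment> \<open>If the gap were larger, an object of rank \<open>Suc (rank M a)\<close> would
      lie strictly between \<open>a\<close> and \<open>b\<close>.\<close>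
    have "rank M b = Suc (rank M a)"
    proof (rule ccontr)
      assume "rank M b \<noteq> Suc (rank M a)"
      with lt have "Suc (rank M a) < rank M b" by simp
      then obtain c where c: "c \<in> sym_int M Obj" "(c, b) \<in> bin_int M RSym" "rank M c = Suc (rank M a)"
        using ex_rank_eq[OF fin Obj[OF arg(2)]] by blast
      then have "a \<noteq> c" "(c, a) \<notin> bin_int M RSym"
        using rank_less[OF fin c(1) Obj[OF arg(1)]] by auto
      then have "(a, c) \<in> bin_int M RSym" using total[OF Obj[OF arg(1)] c(1)] by blast
      with no[OF c(1)] c(2) show False by blast
    qed
    then show ?thesis using a 2 derivable.succ by simp
  next
    case 3
    from clause[OF 3 less.prems(1,2)] obtain c \<nu> ns where c: "c \<in> set Q" "fst (fst c) = p" "ns 0 = e"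
      and h: "\<And>i. i \<le> length (snd c) \<Longrightarrow> holds M \<nu> (ns i) ((fst c # snd c) ! i)"
      and below: "\<And>i. i \<in> {1..length (snd c)} \<Longrightarrow> (ns i, e) \<in> bin_int M RSym" by blast
    obtain "is" b where c': "c = ((p, is), b)" using c(2) by (metis prod.collapse)
    have cl: "((p, is), b) \<in> rec_clauses" using Q c(1) c' by blast
    have len: "length (snd a) = arity (fst a)" if "a \<in> set ((p, is) # b)" for a
      by (rule length_rec_clauses[OF cl that])
    have li: "length is = arity p" using len[of "(p, is)"] by simp
    \<comment> \<open>The clause supplies arguments for the same line \<open>e\<close>; by
      uniqueness they are the given ones. The bound \<open>K\<close> ensures that uniqueness covers
      every position.\<close>
    have "xs = map \<nu> is"
    proof (rule nth_equalityI)
      show "length xs = length (map \<nu> is)" using li less.prems(4) by simp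
      fix j assume j: "j < length xs"
      then have "j < K" using K[OF c(1)] c' less.prems(4) by simp
      moreover have "is_arg M e j (\<nu> (is ! j))"
        using h[of 0] c' c(3) j less.prems(4) li by (simp add: holds_def)
      ultimately show "xs ! j = map \<nu> is ! j"
        using unique[OF less.prems(1) _ less.prems(5)] j li less.prems(4) by simp
    qed
    moreover have "derivable (set Q) (fst a) (map (rank M \<circ> \<nu>) (snd a))" if a: "a \<in> set b" for a
    proof -
      obtain i where i: "i < length b" "a = b ! i" using a by (metis in_set_conv_nth)
      have ha: "holds M \<nu> (ns (Suc i)) a" using h[of "Suc i"] i c' by simp
      then have o: "ns (Suc i) \<in> sym_int M Obj" by (simp add: holds_def)
      have "rank M (ns (Suc i)) < rank M e"
        using below[of "Suc i"] i c' by (intro rank_less[OF fin o less.prems(1)]) simp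
      moreover have "length (snd a) = arity (fst a)" using len a by simp
      moreover have "fst a \<in> set ps \<union> {ZeroP, SuccP}" using ps[OF c(1)] a c' by simp
      moreover have "ns (Suc i) \<in> sym_int M (Fact (fst a))"
        "\<And>j. j < length (snd a) \<Longrightarrow> is_arg M (ns (Suc i)) j (\<nu> (snd a ! j))"
        using ha by (simp_all add: holds_def)
      ultimately have "derivable (set Q) (fst a) (map (rank M) (map \<nu> (snd a)))"
        using o by (intro less.hyps[of "ns (Suc i)"]) simp_all
      then show ?thesis by simp
    qed
    ultimately show ?thesis
      using derivable.clause[of p "is" b "set Q" "rank M \<circ> \<nu>"] c(1) c' by simp
  qed
qed

end

section \<open>Derivations as lists of lines\<close>

definition justified :: "clause set \<Rightarrow> (pred \<times> nat list) set \<Rightarrow> pred \<times> nat list \<Rightarrow> bool" where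
  "justified Q A d \<longleftrightarrow> d = (ZeroP, [0]) \<or> (\<exists>m. d = (SuccP, [m, Suc m])) \<or>
     (\<exists>c \<in> Q. \<exists>\<nu>. d = (fst (fst c), map \<nu> (snd (fst c))) \<and>
       (\<forall>a \<in> set (snd c). (fst a, map \<nu> (snd a)) \<in> A))"

definition is_derivation :: "clause set \<Rightarrow> (pred \<times> nat list) list \<Rightarrow> bool" where
  "is_derivation Q ds \<longleftrightarrow> (\<forall>i < length ds. justified Q (set (take i ds)) (ds ! i))"

lemma justified_mono: "justified Q A d \<Longrightarrow> A \<subseteq> B \<Longrightarrow> justified Q B d"
  unfolding justified_def by blast

lemma is_derivation_append:
  assumes "is_derivation Q ds" "is_derivation Q es"
  shows "is_derivation Q (ds @ es)"
  unfolding is_derivation_def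
proof (intro allI impI)
  fix i assume i: "i < length (ds @ es)"
  show "justified Q (set (take i (ds @ es))) ((ds @ es) ! i)"
  proof (cases "i < length ds")
    case True
    then show ?thesis using assms(1) by (simp add: is_derivation_def nth_append)
  next
    case False
    then have "justified Q (set (take (i - length ds) es)) (es ! (i - length ds))"
      using assms(2) i by (simp add: is_derivation_def)
    then show ?thesis using False by (auto simp: nth_append elim: justified_mono)
  qed
qed

lemma is_derivation_snoc:
  "is_derivation Q ds \<Longrightarrow> justified Q (set ds) d \<Longrightarrow> is_derivation Q (ds @ [d])"
  unfolding is_derivation_def by (auto simp: nth_append less_Suc_eq)

text \<open>Linearizes a derivation tree: the derivations of the premises are concatenated and the
  conclusion is appended.\<close>

lemma derivable_derivation: "derivable Q p xs \<Longrightarrow> \<exists>ds. is_derivation Q ds \<and> (p, xs) \<in> set ds"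
proof (induction rule: derivable.induct)
  case zero
  show ?case by (intro exI[of _ "[(ZeroP, [0])]"]) (simp add: is_derivation_def justified_def)
next
  case (succ m)
  show ?case by (intro exI[of _ "[(SuccP, [m, Suc m])]"]) (simp add: is_derivation_def justified_def)
next
  case (clause p xs b \<nu>)
  have "\<exists>ds. is_derivation Q ds \<and> (\<forall>a \<in> set b'. (fst a, map \<nu> (snd a)) \<in> set ds)"
    if "set b' \<subseteq> set b" for b'
    using that
  proof (induction b')
    case Nil
    show ?case by (intro exI[of _ "[]"]) (simp add: is_derivation_def)
  next
    case (Cons a b')
    then obtain ds where ds: "is_derivation Q ds" "\<forall>a \<in> set b'. (fst a, map \<nu> (snd a)) \<in> set ds"
      by auto
    from Cons.prems clause(2) obtain es where
      es: "is_derivation Q es" "(fst a, map \<nu> (snd a)) \<in> set es" by auto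
    show ?case using ds es is_derivation_append[OF ds(1) es(1)]
      by (intro exI[of _ "ds @ es"]) auto
  qed
  then obtain ds where ds: "is_derivation Q ds" "\<forall>a \<in> set b. (fst a, map \<nu> (snd a)) \<in> set ds"
    by blast
  have "justified Q (set ds) (p, map \<nu> xs)"
    unfolding justified_def using clause(1) ds(2) by force
  then show ?case using is_derivation_snoc[OF ds(1)]
    by (intro exI[of _ "ds @ [(p, map \<nu> xs)]"]) simp
qed

section \<open>From derivations to words\<close>

text \<open>
  The element coded by \<open>(0, a)\<close> is the object of rank \<open>a\<close>, and \<open>(Suc j, a)\<close> is the pointer
  through which lines refer to \<open>a\<close> as their \<open>j\<close>-th argument.
\<close>

definition edge :: "(pred \<times> nat list) list \<Rightarrow> nat \<times> nat \<Rightarrow> nat \<times> nat \<Rightarrow> bool" where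
  "edge ds x y \<longleftrightarrow> (case (x, y) of
      ((0, a), (0, b)) \<Rightarrow> a < b
    | ((0, e), (Suc j, a)) \<Rightarrow> e < length ds \<and> j < length (snd (ds ! e)) \<and> snd (ds ! e) ! j = a
    | ((Suc j, a), (0, b)) \<Rightarrow> a = b
    | ((Suc j, a), (Suc k, b)) \<Rightarrow> False)"

definition sym_holds :: "nat \<Rightarrow> (pred \<times> nat list) list \<Rightarrow> sym \<Rightarrow> nat \<times> nat \<Rightarrow> bool" where
  "sym_holds n ds s x \<longleftrightarrow> (case s of
      Obj \<Rightarrow> fst x = 0
    | Inp \<Rightarrow> x = (0, n)
    | Tag j \<Rightarrow> fst x = Suc j
    | Fact p \<Rightarrow> fst x = 0 \<and> snd x < length ds \<and> fst (ds ! snd x) = p)"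

text \<open>Row 0 consists of the objects and row \<open>Suc j\<close> of the pointers for position
  \<open>j\<close>, so rows up to \<open>K\<close> serve the positions below
  \<open>K\<close>.\<close>

definition word_univ :: "nat \<Rightarrow> nat \<Rightarrow> nat set" where
  "word_univ K L = prod_encode ` ({..K} \<times> {..<L})"

text \<open>All unary symbols are interpreted at once through \<open>from_nat\<close>. The
  restriction to a finite signature, which makes this a word, is made afterwards.\<close>

definition word_model :: "nat \<Rightarrow> nat \<Rightarrow> nat \<Rightarrow> (pred \<times> nat list) list \<Rightarrow> nat struct" where
  "word_model K L n ds = \<lparr>univ = word_univ K L,
     un_int = (\<lambda>P. {x \<in> word_univ K L. sym_holds n ds (from_nat P) (prod_decode x)}),
     bin_int = (\<lambda>b. case b of
         LessSym \<Rightarrow> {(x, y) \<in> word_univ K L \<times> word_univ K L. x < y}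
       | SuccSym \<Rightarrow> induced_succ {(x, y) \<in> word_univ K L \<times> word_univ K L. x < y}
       | RSym \<Rightarrow> {(x, y) \<in> word_univ K L \<times> word_univ K L. edge ds (prod_decode x) (prod_decode y)})\<rparr>"

lemma prod_encode_word_univ [simp]: "prod_encode (t, a) \<in> word_univ K L \<longleftrightarrow> t \<le> K \<and> a < L"
  by (auto simp: word_univ_def)

lemma univ_word_model [simp]: "univ (word_model K L n ds) = word_univ K L"
  by (simp add: word_model_def)

lemma finite_word_univ: "finite (word_univ K L)"
  by (simp add: word_univ_def)

lemma sym_word_model [simp]:
  "prod_encode (t, a) \<in> sym_int (word_model K L n ds) s \<longleftrightarrow> t \<le> K \<and> a < L \<and> sym_holds n ds s (t, a)"
  by (simp add: word_model_def)

lemma edge_word_model [simp]: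
  "(prod_encode (t, a), prod_encode (u, b)) \<in> bin_int (word_model K L n ds) RSym \<longleftrightarrow>
     t \<le> K \<and> a < L \<and> u \<le> K \<and> b < L \<and> edge ds (t, a) (u, b)"
  by (simp add: word_model_def)

lemma Obj_word_model: "sym_int (word_model K L n ds) Obj = (\<lambda>a. prod_encode (0, a)) ` {..<L}"
proof -
  have "x \<in> sym_int (word_model K L n ds) Obj \<longleftrightarrow> x \<in> (\<lambda>a. prod_encode (0, a)) ` {..<L}" for x
    by (cases "prod_decode x") (auto simp: word_model_def word_univ_def sym_holds_def)
  then show ?thesis by blast
qed

text \<open>An element tagged \<open>j\<close> lies in row \<open>Suc j\<close>, and its only edge
  leads to the object of its own column. The bounds on \<open>j\<close> and on the value say that
  this pointer belongs to the universe.\<close>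

lemma is_arg_word_model:
  assumes "e < L"
  shows "is_arg (word_model K L n ds) (prod_encode (0, e)) j x \<longleftrightarrow>
    e < length ds \<and> j < length (snd (ds ! e)) \<and> j < K \<and> snd (ds ! e) ! j < L \<and>
    x = prod_encode (0, snd (ds ! e) ! j)" (is "?L \<longleftrightarrow> ?R")
proof
  assume ?L
  then obtain p where p: "p \<in> word_univ K L" "p \<in> sym_int (word_model K L n ds) (Tag j)"
    "(prod_encode (0, e), p) \<in> bin_int (word_model K L n ds) RSym"
    "(p, x) \<in> bin_int (word_model K L n ds) RSym" "x \<in> sym_int (word_model K L n ds) Obj"
    unfolding is_arg_def by auto
  from p(1) obtain t a where t: "p = prod_encode (t, a)" by (auto simp: word_univ_def)
  from p(5) obtain b where b: "x = prod_encode (0, b)" "b < L" by (auto simp: Obj_word_model)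
  from p(2) t have "t = Suc j" "Suc j \<le> K" by (auto simp: sym_holds_def)
  with p(3,4) t b show ?R by (auto simp: edge_def)
next
  assume ?R
  then show ?L using assms unfolding is_arg_def
    by (intro bexI[of _ "prod_encode (Suc j, snd (ds ! e) ! j)"]) (auto simp: sym_holds_def edge_def)
qed

lemma rank_word_model:
  assumes "a < L"
  shows "rank (word_model K L n ds) (prod_encode (0, a)) = a"
proof -
  have "{c \<in> sym_int (word_model K L n ds) Obj. (c, prod_encode (0, a)) \<in> bin_int (word_model K L n ds) RSym}
      = (\<lambda>a. prod_encode (0, a)) ` {..<a}"
    using assms by (auto simp: Obj_word_model edge_def)
  moreover have "inj_on (\<lambda>a. prod_encode (0, a)) {..<a}" by (auto intro!: inj_onI)
  ultimately show ?thesis unfolding rank_def by (simp add: card_image)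
qed

lemma word_restrict_word_model:
  assumes "0 < L" "finite \<sigma>"
  shows "word \<sigma> ((word_model K L n ds)\<lparr>un_int := \<lambda>P. if P \<in> \<sigma> then un_int (word_model K L n ds) P else {}\<rparr>)"
proof -
  have "word_univ K L \<noteq> {}" using assms(1) by (simp add: word_univ_def lessThan_empty_iff)
  moreover have "strict_linear_order_on (word_univ K L) {(x, y) \<in> word_univ K L \<times> word_univ K L. x < y}"
    unfolding strict_linear_order_on_def by (auto simp: trans_def irrefl_def total_on_def)
  ultimately show ?thesis
    unfolding word_def using assms(2) by (auto simp: word_model_def finite_word_univ)
qed

lemma satisfiable_if_models_word_model:
  assumes "0 < L" and M: "models (word_model K L n ds) \<phi>"
  shows "satisfiable_over_words \<phi>"
proof -
  let ?M = "word_model K L n ds"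
  let ?N = "?M\<lparr>un_int := \<lambda>P. if P \<in> unary_syms \<phi> then un_int ?M P else {}\<rparr>"
  have "sat ?N v \<phi> \<longleftrightarrow> sat ?M v \<phi>" for v
    by (rule sat_struct_cong) simp_all
  with M have "models ?N \<phi>" by (simp add: models_def)
  moreover have "word (unary_syms \<phi>) ?N"
    by (rule word_restrict_word_model[OF assms(1) finite_unary_syms])
  ultimately show ?thesis unfolding satisfiable_over_words_def by blast
qed

text \<open>On objects \<open>R\<close> is the order of the indices, so the premises of a line,
  which occur earlier in the derivation, lie \<open>R\<close>-below it.\<close>

lemma program_model_word_model:
  assumes K: "0 < K" and ds: "is_derivation (set Q) ds"
    and len: "\<And>d. d \<in> set ds \<Longrightarrow> length (snd d) \<le> K"
    and L: "length ds \<le> L" "\<And>d x. d \<in> set ds \<Longrightarrow> x \<in> set (snd d) \<Longrightarrow> x < L"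
    and ps: "ZeroP \<notin> set ps" "SuccP \<notin> set ps"
    and Q: "\<And>c. c \<in> set Q \<Longrightarrow> fst (fst c) \<noteq> ZeroP \<and> fst (fst c) \<noteq> SuccP"
    and goal: "(g, [0, n]) \<in> set ds" "(ZeroP, [0]) \<in> set ds"
  shows "program_model (word_model K L n ds) K Q ps g"
proof -
  let ?M = "word_model K L n ds" and ?o = "\<lambda>a. prod_encode (0, a)"
  have "0 < L" using L(2)[OF goal(2)] by simp
  have holds: "holds ?M \<nu> (?o i) (q, is)"
    if "i < length ds" "ds ! i = (q, map \<mu> is)" "\<And>x. x \<in> set is \<Longrightarrow> \<nu> x = ?o (\<mu> x)" for i q "is" \<mu> \<nu>
  proof -
    have "ds ! i \<in> set ds" "i < L" using that(1) L(1) by auto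
    have "is_arg ?M (?o i) j (\<nu> (is ! j))" if "j < length is" for j
      unfolding is_arg_word_model[OF \<open>i < L\<close>]
      using len[OF \<open>ds ! i \<in> set ds\<close>] L(2)[OF \<open>ds ! i \<in> set ds\<close>] that \<open>i < length ds\<close>
        \<open>ds ! i = (q, map \<mu> is)\<close> \<open>\<And>x. x \<in> set is \<Longrightarrow> \<nu> x = ?o (\<mu> x)\<close> by simp
    then show ?thesis
      unfolding holds_def using that(1,2) \<open>i < L\<close> by (simp add: sym_holds_def)
  qed
  have just: "justified (set Q) (set (take i ds)) (ds ! i)" if "i < length ds" for i
    using ds that by (simp add: is_derivation_def)
  show ?thesis
  proof
    fix a assume "a \<in> sym_int ?M Obj"
    then show "(a, a) \<notin> bin_int ?M RSym" by (auto simp: Obj_word_model edge_def)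
  next
    fix a b c assume "a \<in> sym_int ?M Obj" "b \<in> sym_int ?M Obj" "c \<in> sym_int ?M Obj"
      "(a, b) \<in> bin_int ?M RSym" "(b, c) \<in> bin_int ?M RSym"
    then show "(a, c) \<in> bin_int ?M RSym" by (auto simp: Obj_word_model edge_def)
  next
    fix a b assume "a \<in> sym_int ?M Obj" "b \<in> sym_int ?M Obj"
    then show "a = b \<or> (a, b) \<in> bin_int ?M RSym \<or> (b, a) \<in> bin_int ?M RSym"
      by (auto simp: Obj_word_model edge_def)
  next
    fix e j a b assume "e \<in> sym_int ?M Obj" "is_arg ?M e j a" "is_arg ?M e j b"
    then show "a = b" by (auto simp: Obj_word_model is_arg_word_model)
  next
    fix e a c assume "e \<in> sym_int ?M Obj" "e \<in> sym_int ?M (Fact ZeroP)" and arg: "is_arg ?M e 0 a"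
      and "c \<in> sym_int ?M Obj"
    then obtain i k where i: "e = ?o i" "i < L" "i < length ds" "fst (ds ! i) = ZeroP"
      and c: "c = ?o k" by (auto simp: Obj_word_model sym_holds_def)
    \<comment> \<open>No clause has a built-in predicate in its head, so such a line can only be the
      built-in fact itself.\<close>
    have "ds ! i = (ZeroP, [0])" using just[OF i(3)] i(4) unfolding justified_def by (auto dest: Q)
    with arg i have "a = ?o 0" by (simp add: is_arg_word_model)
    with c show "(c, a) \<notin> bin_int ?M RSym" by (simp add: edge_def)
  next
    fix e a b assume "e \<in> sym_int ?M Obj" "e \<in> sym_int ?M (Fact SuccP)"
      and arg: "is_arg ?M e 0 a" "is_arg ?M e 1 b"
    then obtain i where i: "e = ?o i" "i < L" "i < length ds" "fst (ds ! i) = SuccP"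
      by (auto simp: Obj_word_model sym_holds_def)
    obtain m where m: "ds ! i = (SuccP, [m, Suc m])"
      using just[OF i(3)] i(4) unfolding justified_def by (auto dest: Q)
    with arg i have "a = ?o m" "b = ?o (Suc m)" "m < L" "Suc m < L"
      by (simp_all add: is_arg_word_model)
    then show "(a, b) \<in> bin_int ?M RSym \<and>
        \<not> (\<exists>c \<in> sym_int ?M Obj. (a, c) \<in> bin_int ?M RSym \<and> (c, b) \<in> bin_int ?M RSym)"
      by (auto simp: Obj_word_model edge_def)
  next
    fix p e assume p: "p \<in> set ps" and "e \<in> sym_int ?M Obj" "e \<in> sym_int ?M (Fact p)"
    then obtain i where i: "e = ?o i" "i < L" "i < length ds" "fst (ds ! i) = p"
      by (auto simp: Obj_word_model sym_holds_def)
    have "p \<noteq> ZeroP" "p \<noteq> SuccP" using p ps by auto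
    with just[OF i(3)] i(4) obtain c \<mu> where c: "c \<in> set Q" "ds ! i = (fst (fst c), map \<mu> (snd (fst c)))"
      "\<forall>a \<in> set (snd c). (fst a, map \<mu> (snd a)) \<in> set (take i ds)"
      unfolding justified_def by auto
    have "\<exists>k < i. ds ! k = (fst a, map \<mu> (snd a))" if "a \<in> set (snd c)" for a
    proof -
      have "(fst a, map \<mu> (snd a)) \<in> set (take i ds)" using c(3) that by blast
      then obtain k where "k < length (take i ds)" "take i ds ! k = (fst a, map \<mu> (snd a))"
        by (metis in_set_conv_nth)
      then show ?thesis by auto
    qed
    then obtain ix where ix: "\<And>a. a \<in> set (snd c) \<Longrightarrow> ix a < i \<and> ds ! ix a = (fst a, map \<mu> (snd a))"
      by metis
    \<comment> \<open>Variables of the clause have values below \<open>L\<close>. Elsewhere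
      \<open>\<mu>\<close> may exceed \<open>L\<close>, and the default 0 keeps \<open>\<nu>\<close>
      inside the universe.\<close>
    define \<nu> where "\<nu> x = ?o (if \<mu> x < L then \<mu> x else 0)" for x
    \<comment> \<open>\<open>Node 0\<close> is the head, so body atom \<open>k - 1\<close> belongs
      to \<open>Node k\<close>; all other indices default to the head line.\<close>
    define ns where "ns k = (if k \<in> {1..length (snd c)} then ?o (ix (snd c ! (k - 1))) else e)" for k
    have \<nu>: "\<nu> x = ?o (\<mu> x)" if "(q, map \<mu> is) \<in> set ds" "x \<in> set is" for x q "is"
      using L(2)[OF that(1), of "\<mu> x"] that(2) by (simp add: \<nu>_def)
    have "ds ! i \<in> set ds" using i(3) by simp
    then have 0: "holds ?M \<nu> e (fst c)"
      using holds[OF i(3), of "fst (fst c)" \<mu> "snd (fst c)" \<nu>] \<nu> c(2) i(1) by simp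
    have S: "holds ?M \<nu> (?o (ix a)) a" if "a \<in> set (snd c)" for a
    proof -
      have "ix a < length ds" using ix[OF that] i(3) by simp
      then have "ds ! ix a \<in> set ds" by simp
      with holds[OF \<open>ix a < length ds\<close>, of "fst a" \<mu> "snd a" \<nu>] ix[OF that] \<nu> show ?thesis by simp
    qed
    have "holds ?M \<nu> (ns k) ((fst c # snd c) ! k)" if "k \<le> length (snd c)" for k
      using 0 S that by (cases k) (auto simp: ns_def)
    moreover have "(ns k, e) \<in> bin_int ?M RSym" if k: "k \<in> {1..length (snd c)}" for k
    proof -
      have "snd c ! (k - 1) \<in> set (snd c)" using k by auto
      from ix[OF this] k i(1,2) show ?thesis by (simp add: ns_def edge_def)
    qed
    moreover have "range \<nu> \<subseteq> univ ?M" using \<open>0 < L\<close> by (auto simp: \<nu>_def)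
    moreover have "range ns \<subseteq> univ ?M"
    proof
      fix x assume "x \<in> range ns"
      then obtain k where k: "x = ns k" by blast
      show "x \<in> univ ?M"
      proof (cases "k \<in> {1..length (snd c)}")
        case True
        then have "snd c ! (k - 1) \<in> set (snd c)" by auto
        from ix[OF this] True i(1,2) show ?thesis by (simp add: ns_def k)
      next
        case False
        then show ?thesis using i(1,2) unfolding k by (auto simp: ns_def)
      qed
    qed
    moreover have "ns 0 = e" by (simp add: ns_def)
    moreover have "fst (fst c) = p" using c(2) i(4) by simp
    ultimately show "\<exists>c \<in> set Q. \<exists>\<nu> ns. fst (fst c) = p \<and> range \<nu> \<subseteq> univ ?M \<and> range ns \<subseteq> univ ?M \<and> ns 0 = e \<and>
        (\<forall>i \<le> length (snd c). holds ?M \<nu> (ns i) ((fst c # snd c) ! i)) \<and>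
        (\<forall>i \<in> {1..length (snd c)}. (ns i, e) \<in> bin_int ?M RSym)"
      using c(1) by blast
  next
    define \<mu> where "\<mu> x = (if x = (1::nat) then n else 0)" for x
    obtain i where i: "i < length ds" "ds ! i = (g, [0, n])" using goal(1) by (metis in_set_conv_nth)
    obtain k where k: "k < length ds" "ds ! k = (ZeroP, [0])" using goal(2) by (metis in_set_conv_nth)
    have "n < L" using L(2)[OF goal(1)] by simp
    let ?\<nu> = "\<lambda>x. ?o (\<mu> x)"
    have "holds ?M ?\<nu> (?o i) (g, [0, 1])"
      by (rule holds[OF i(1)]) (simp_all add: i(2) \<mu>_def)
    moreover have "holds ?M ?\<nu> (?o k) (ZeroP, [0])"
      by (rule holds[OF k(1)]) (simp_all add: k(2) \<mu>_def)
    moreover have "?\<nu> 1 \<in> sym_int ?M Inp" "range ?\<nu> \<subseteq> univ ?M"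
      using \<open>n < L\<close> \<open>0 < L\<close> by (auto simp: \<mu>_def sym_holds_def)
    ultimately show "\<exists>\<nu> e z. range \<nu> \<subseteq> univ ?M \<and> holds ?M \<nu> e (g, [0, 1]) \<and>
        holds ?M \<nu> z (ZeroP, [0]) \<and> \<nu> 1 \<in> sym_int ?M Inp" by blast
  qed
qed

section \<open>Correctness of the reduction\<close>

lemma program_fm_satisfiable_if_derivable:
  assumes Q: "set Q \<subseteq> rec_clauses" and K: "2 \<le> K" "\<And>c. c \<in> set Q \<Longrightarrow> arity (fst (fst c)) \<le> K"
    and ps: "ZeroP \<notin> set ps" "SuccP \<notin> set ps"
    and der: "derivable (set Q) g [0, n]"
  shows "satisfiable_over_words (Conj (program_fm K Q ps g) (input_fm n))"
proof -
  obtain ds' where ds': "is_derivation (set Q) ds'" "(g, [0, n]) \<in> set ds'"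
    using derivable_derivation[OF der] by blast
  \<comment> \<open>The goal axiom asks for a line stating that 0 is zero, which the derivation of
    the goal might not contain.\<close>
  obtain es where es: "is_derivation (set Q) es" "(ZeroP, [0]) \<in> set es"
    using derivable_derivation[OF derivable.zero[of "set Q"]] by blast
  define ds where "ds = ds' @ es"
  have ds: "is_derivation (set Q) ds" "(g, [0, n]) \<in> set ds" "(ZeroP, [0]) \<in> set ds"
    using ds' es unfolding ds_def by (simp_all add: is_derivation_append)
  \<comment> \<open>Large enough to provide an object for every line and for every number occurring
    in a line.\<close>
  define L where "L = Suc (length ds + (\<Sum>d\<leftarrow>ds. sum_list (snd d)))"
  have L: "x < L" if "d \<in> set ds" "x \<in> set (snd d)" for d x
  proof -
    have "sum_list (snd d) \<in> set (map (\<lambda>d. sum_list (snd d)) ds)" using that(1) by simp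
    from member_le_sum_list[OF this] member_le_sum_list[OF that(2)] show ?thesis
      unfolding L_def by linarith
  qed
  have head: "length (snd (fst c)) = arity (fst (fst c))" "fst (fst c) \<noteq> ZeroP \<and> fst (fst c) \<noteq> SuccP"
    if c: "c \<in> set Q" for c
  proof -
    have cl: "((fst (fst c), snd (fst c)), snd c) \<in> rec_clauses" using subsetD[OF Q c] by simp
    show "length (snd (fst c)) = arity (fst (fst c))" using length_rec_clauses[OF cl, of "fst c"] by simp
    show "fst (fst c) \<noteq> ZeroP \<and> fst (fst c) \<noteq> SuccP" by (rule rec_clauses_head[OF cl])
  qed
  have len: "length (snd d) \<le> K" if d: "d \<in> set ds" for d
  proof -
    obtain i where i: "i < length ds" "ds ! i = d" using d unfolding in_set_conv_nth by blast
    have "justified (set Q) (set (take i ds)) (ds ! i)"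
      using ds(1) i(1) unfolding is_derivation_def by blast
    then have "justified (set Q) (set (take i ds)) d" unfolding i(2) .
    then show ?thesis unfolding justified_def
    proof (elim disjE exE bexE conjE)
      assume "d = (ZeroP, [0])"
      then have "length (snd d) = 1" by simp
      then show ?thesis using K(1) by linarith
    next
      fix m assume "d = (SuccP, [m, Suc m])"
      then have "length (snd d) = 2" by simp
      then show ?thesis using K(1) by linarith
    next
      fix c \<nu> assume c: "c \<in> set Q" and d: "d = (fst (fst c), map \<nu> (snd (fst c)))"
      from d have "length (snd d) = length (snd (fst c))" by simp
      with head(1)[OF c] K(2)[OF c] show ?thesis by linarith
    qed
  qed
  have "0 < L" "0 < K" "length ds \<le> L" using K(1) by (simp_all add: L_def)
  let ?M = "word_model K L n ds"
  interpret program_model ?M K Q ps g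
    by (rule program_model_word_model[OF \<open>0 < K\<close> ds(1) len \<open>length ds \<le> L\<close> L ps head(2) ds(2,3)])
  have ne: "univ ?M \<noteq> {}" using \<open>0 < L\<close> by (simp add: word_univ_def lessThan_empty_iff)
  have un: "un_int ?M P \<subseteq> univ ?M" for P by (auto simp: word_model_def)
  have Inp: "x = prod_encode (0, n) \<and> n < L" if x: "x \<in> sym_int ?M Inp" for x
  proof -
    have "x \<in> word_univ K L" using subsetD[OF un x] by simp
    then obtain t a where "x = prod_encode (t, a)" unfolding word_univ_def by auto
    with x show ?thesis by (simp add: sym_holds_def)
  qed
  have "models ?M (input_fm n)"
  proof (rule models_input_fm[OF ne _ un])
    show "finite (sym_int ?M Obj)" by (simp add: Obj_word_model)
    show "sym_int ?M Inp \<subseteq> sym_int ?M Obj" using Inp by (auto simp: Obj_word_model)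
    show "rank ?M x = n" if "x \<in> sym_int ?M Inp" for x
      using Inp[OF that] rank_word_model by simp
  qed
  then have "models ?M (Conj (program_fm K Q ps g) (input_fm n))"
    using models_program_fm[OF ne un] by (simp only: models_Conj)
  with \<open>0 < L\<close> show ?thesis by (rule satisfiable_if_models_word_model)
qed

lemma derivable_if_program_fm_satisfiable:
  assumes Q: "set Q \<subseteq> rec_clauses" and K: "\<And>c. c \<in> set Q \<Longrightarrow> arity (fst (fst c)) \<le> K"
    and ps: "\<And>c a. c \<in> set Q \<Longrightarrow> a \<in> set (snd c) \<Longrightarrow> fst a \<in> set ps \<union> {ZeroP, SuccP}"
    and g: "g \<in> set ps" "arity g = 2"
    and sat: "satisfiable_over_words (Conj (program_fm K Q ps g) (input_fm n))"
  shows "derivable (set Q) g [0, n]"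
proof -
  from sat obtain \<sigma> and M :: "nat struct" where M: "word \<sigma> M"
    "models M (program_fm K Q ps g)" "models M (input_fm n)"
    unfolding satisfiable_over_words_def by auto
  have ne: "univ M \<noteq> {}" and "finite (univ M)" using M(1) unfolding word_def by blast+
  have un: "un_int M P \<subseteq> univ M" for P using M(1) unfolding word_def by (cases "P \<in> \<sigma>") simp_all
  have fin: "finite (sym_int M Obj)" by (rule finite_subset[OF un \<open>finite (univ M)\<close>])
  interpret program_model M K Q ps g by (rule program_model_if_models[OF ne un M(2)])
  obtain \<nu> e z where h: "holds M \<nu> e (g, [0, 1])" "holds M \<nu> z (ZeroP, [0])" "\<nu> 1 \<in> sym_int M Inp"
    using goal by blast
  have arg: "is_arg M e 0 (\<nu> 0)" "is_arg M e 1 (\<nu> 1)" "is_arg M z 0 (\<nu> 0)"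
    using h(1,2) by (auto simp: holds_def All_less_Suc numeral_2_eq_2)
  then have "\<nu> 1 \<in> sym_int M Obj" unfolding is_arg_def by blast
  then have 1: "rank M (\<nu> 1) = n" using rank_input[OF fin un M(3)] h(3) by blast
  \<comment> \<open>The line \<open>z\<close> shares the object \<open>\<nu> 0\<close> with the goal
    line and so fixes the value of the function to be 0.\<close>
  have "derivable (set Q) ZeroP (map (rank M) [\<nu> 0])"
    by (rule derivable_if_fact[OF fin Q K ps, where e = z]) (use h(2) arg in \<open>auto simp: holds_def\<close>)
  then have "meaning ZeroP (map (rank M) [\<nu> 0])" using Q by (rule derivable_meaning)
  then have 0: "rank M (\<nu> 0) = 0" by simp
  have "derivable (set Q) g (map (rank M) [\<nu> 0, \<nu> 1])"
    by (rule derivable_if_fact[OF fin Q K ps, where e = e])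
      (use h(1) arg g in \<open>auto simp: holds_def less_2_cases_iff\<close>)
  then show ?thesis using 0 1 by simp
qed

text \<open>One sentence serves all inputs. This order of quantifiers is what allows the sentence to
  be confronted with its own code.\<close>

lemma ex_program_fm:
  "\<exists>\<psi> \<in> F1_R. fv \<psi> = {} \<and>
     (\<forall>n. satisfiable_over_words (Conj \<psi> (input_fm n)) \<longleftrightarrow> rec_eval f [n] 0)"
proof -
  obtain Q0 where Q0: "finite Q0" "Q0 \<subseteq> rec_clauses"
    "\<And>xs y. length xs = 1 \<Longrightarrow> rec_eval f xs y \<Longrightarrow> derivable Q0 (EvP f 1) (y # xs)"
    using has_program[of f 1] unfolding has_program_def by blast
  obtain Q where Q: "set Q = Q0" using finite_list[OF Q0(1)] by blast
  \<comment> \<open>The predicates whose lines need a justification by clauses: the goal and all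
    body predicates. The built-in ones have their own axioms.\<close>
  define ps where "ps = EvP f 1 # filter (\<lambda>p. p \<noteq> ZeroP \<and> p \<noteq> SuccP) (concat (map (\<lambda>c. map fst (snd c)) Q))"
  \<comment> \<open>A crude common bound for the arities of the heads; the summand 2 leaves room for
    \<open>SuccP\<close>.\<close>
  define K where "K = 2 + (\<Sum>c\<leftarrow>Q. arity (fst (fst c)))"
  have K: "arity (fst (fst c)) \<le> K" if "c \<in> set Q" for c
  proof -
    have "arity (fst (fst c)) \<in> set (map (\<lambda>c. arity (fst (fst c))) Q)" using that by simp
    from member_le_sum_list[OF this] show ?thesis unfolding K_def by linarith
  qed
  have ps: "fst a \<in> set ps \<union> {ZeroP, SuccP}" if "c \<in> set Q" "a \<in> set (snd c)" for c a
    using that by (auto simp: ps_def)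
  have "satisfiable_over_words (Conj (program_fm K Q ps (EvP f 1)) (input_fm n)) \<longleftrightarrow> rec_eval f [n] 0" for n
  proof
    assume "satisfiable_over_words (Conj (program_fm K Q ps (EvP f 1)) (input_fm n))"
    then have "derivable (set Q) (EvP f 1) [0, n]"
      using Q Q0(2) K ps by (intro derivable_if_program_fm_satisfiable[of Q K ps]) (auto simp: ps_def)
    from derivable_meaning[OF this] show "rec_eval f [n] 0" using Q Q0(2) by simp
  next
    assume "rec_eval f [n] 0"
    then have "derivable (set Q) (EvP f 1) [0, n]" using Q0(3)[of "[n]" 0] Q by simp
    then show "satisfiable_over_words (Conj (program_fm K Q ps (EvP f 1)) (input_fm n))"
      using Q Q0(2) K by (intro program_fm_satisfiable_if_derivable) (auto simp: ps_def K_def)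
  qed
  moreover have "fv (program_fm K Q ps (EvP f 1)) = {}" by (simp add: program_fm_def)
  ultimately show ?thesis using program_fm_F1_R by blast
qed

section \<open>Computing the codes of the input sentences\<close>

definition conj_code :: "nat \<Rightarrow> nat \<Rightarrow> nat" where
  "conj_code a b = prod_encode (3, prod_encode (4, prod_encode (prod_encode (3, a), prod_encode (3, b))))"

lemma fm_code_Conj: "fm_code (Conj \<phi> \<psi>) = conj_code (fm_code \<phi>) (fm_code \<psi>)"
  by (simp add: Conj_def conj_code_def)

lemma computable_conj_code:
  "computable F \<Longrightarrow> computable G \<Longrightarrow> computable (\<lambda>x. conj_code (F x) (G x))"
  unfolding conj_code_def by (intro computable_prod_encode computable_const)

definition rank_step_code :: "nat \<Rightarrow> nat" where
  "rank_step_code c = prod_encode (5, prod_encode (1, conj_code (fm_code (Conj (U Obj 1) (R 1 0)))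
     (prod_encode (5, prod_encode (0, conj_code (fm_code (Equal 0 1)) c)))))"

lemma fm_code_rank_step: "fm_code (rank_step \<phi>) = rank_step_code (fm_code \<phi>)"
  by (simp only: rank_step_def rank_step_code_def fm_code.simps(6) fm_code_Conj)

lemma fm_code_rank_ge_fm: "fm_code (rank_ge_fm n) = (rank_step_code ^^ n) (fm_code (Equal 0 0))"
  unfolding rank_ge_fm_def by (induction n) (simp_all del: fm_code.simps add: fm_code_rank_step)

lemma computable_rank_step_code: "computable F \<Longrightarrow> computable (\<lambda>x. rank_step_code (F x))"
  unfolding rank_step_code_def
  by (intro computable_prod_encode computable_conj_code computable_const)

lemma computable_input_fm: "computable (\<lambda>n. fm_code (input_fm n))"
proof -
  let ?r = "\<lambda>n. (rank_step_code ^^ n) (fm_code (Equal 0 0))"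
  have "fm_code (input_fm n) = prod_encode (3, prod_encode (5, prod_encode (0,
      conj_code (fm_code (U Inp 0)) (prod_encode (3, conj_code (?r n) (prod_encode (3, rank_step_code (?r n))))))))" for n
    by (simp only: input_fm_def fm_code.simps(4,6) fm_code_Conj fm_code_rank_ge_fm funpow.simps(2) o_apply)
  moreover have "computable ?r"
    by (rule computable_funpow[OF computable_rank_step_code[OF computable_id]])
  ultimately show ?thesis
    by (auto intro!: computable_prod_encode computable_const computable_conj_code computable_rank_step_code)
qed

section \<open>Diagonalization\<close>

lemma undecidable_if_contains_F1_R:
  assumes I: "\<And>\<phi>. \<phi> \<in> F1_R \<Longrightarrow> fv \<phi> = {} \<Longrightarrow> \<phi> \<in> I"
  shows "\<not> decidable_problem fm_code I satisfiable_over_words"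
proof
  assume "decidable_problem fm_code I satisfiable_over_words"
  then obtain d where d: "\<And>\<phi>. \<phi> \<in> I \<Longrightarrow> rec_eval d [fm_code \<phi>] (if satisfiable_over_words \<phi> then 1 else 0)"
    unfolding decidable_problem_def by blast
  have "computable (\<lambda>n. conj_code n (fm_code (input_fm n)))"
    by (intro computable_conj_code computable_id computable_input_fm)
  then obtain h where h: "\<And>n. rec_eval h [n] (conj_code n (fm_code (input_fm n)))"
    unfolding computable_def by blast
  \<comment> \<open>Stated as an equivalence between evaluations, since \<open>d\<close> may diverge
    on numbers that code no instance. Left to right uses that the value of \<open>h\<close> is
    determined.\<close>
  have diag: "rec_eval (Comp d [h]) [n] y \<longleftrightarrow> rec_eval d [conj_code n (fm_code (input_fm n))] y" for n y
  proof
    assume "rec_eval (Comp d [h]) [n] y"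
    then obtain zs where "list_all2 (\<lambda>g y. rec_eval g [n] y) [h] zs" "rec_eval d zs y"
      by (rule rec_eval_Comp)
    then obtain z where "rec_eval h [n] z" "rec_eval d [z] y"
      by (auto simp: list_all2_Cons1)
    then show "rec_eval d [conj_code n (fm_code (input_fm n))] y"
      using rec_eval_deterministic[OF h] by metis
  qed (rule rec_eval_comp1[OF h])
  obtain \<psi> where \<psi>: "\<psi> \<in> F1_R" "fv \<psi> = {}"
    "\<And>n. satisfiable_over_words (Conj \<psi> (input_fm n)) \<longleftrightarrow> rec_eval (Comp d [h]) [n] 0"
    using ex_program_fm[of "Comp d [h]"] by blast
  let ?\<phi> = "Conj \<psi> (input_fm (fm_code \<psi>))"
  \<comment> \<open>By the choice of \<open>\<psi>\<close>, the sentence is satisfiable exactly if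
    \<open>d\<close> answers 0 on its code, that is, declares it unsatisfiable.\<close>
  have sat: "satisfiable_over_words ?\<phi> \<longleftrightarrow> rec_eval d [fm_code ?\<phi>] 0"
    by (simp only: \<psi>(3) diag fm_code_Conj)
  have "?\<phi> \<in> I" using \<psi> by (intro I F1_R_Conj input_fm_F1_R) (simp_all add: fv_input_fm)
  from d[OF this] show False
    using sat rec_eval_deterministic[of d "[fm_code ?\<phi>]" 0 1] by (auto split: if_splits)
qed

theorem theorem4p10:
  "\<not> decidable_problem fm_code (F1_sentences SuccSym) satisfiable_over_words \<and>
   \<not> decidable_problem fm_code (F1_sentences LessSym) satisfiable_over_words"
  by (intro conjI undecidable_if_contains_F1_R) (auto simp: F1_sentences_def F1_R_def)

end
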